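(* Let $M$ be a given symmetric $n\times n$ real matrix and consider, under the assumptions of the context, the delayed Riccati equation $$\left\{\begin{aligned}\dot\Sigma(t)=&-\Sigma(t)A(t)^\top-A(t)\Sigma(t)+2\Sigma(t)[Q(t)+\bar Q(t+\delta)]\Sigma(t)-B(t)\Sigma(t)\mathcal M^{-1}(t)B(t)^\top-C(t)\mathcal N^{-1}(t)C(t)^\top\\&-\bar B(t)\Sigma(t-\delta)\mathcal M^{-1}(t-\delta)\bar B(t)^\top-\bar C(t)\mathcal N^{-1}(t-\delta)\bar C(t)^\top,\quad t\in[s,T],\\\Sigma(T)=&\ M,\qquad\Sigma(t)=I,\ t\in[s-\delta,s),\end{aligned}\right.$$ where $\mathcal M(t):=2R(t)\Sigma(t)+2\bar R(t+\delta)\Sigma(t)+I$ and $\mathcal N(t):=2N(t)+2\bar N(t+\delta)$. If a solution $\Sigma(\cdot)$ of this equation satisfies $\Sigma(\cdot)\in C([s,T];\mathbf S^n_+)$, then it is unique; that is, the equation has at most one solution in $C([s,T];\mathbf S^n_+)$.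
   Context: $T>0$, $s\in[0,T]$, and $\delta>0$ is a sufficiently small delay (there is $\delta_0>0$ depending only on $T$ and on bounds of the data such that $0<\delta\le\delta_0$ is assumed). $\mathbf S^n$ is the space of symmetric $n\times n$ real matrices, $\mathbf S^n_+$ the subset of positive semidefinite ones. All coefficients are deterministic bounded measurable functions, defined at all times at which they are evaluated: $A,B,\bar B$ are $\mathbf R^{n\times n}$-valued, $C,\bar C$ are $\mathbf R^{n\times d}$-valued, $Q,\bar Q,R,\bar R$ are $\mathbf S^n$-valued, $N,\bar N$ are $\mathbf S^d$-valued, and for some $\alpha>0$: $Q(t)+\bar Q(t+\delta)\ge0$, $R(t)+\bar R(t+\delta)\ge0$, $N(t)+\bar N(t+\delta)\ge\alpha I$ for a.e. $t\in[s-\delta,T]$. The prescribed values $\Sigma=I$ on $[s-\delta,s)$ are not required to match $\Sigma(s)$. *)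

theory Defs
  imports "HOL-Analysis.Analysis"
begin

definition psd :: "real^'n^'n \<Rightarrow> bool" where
  "psd X \<longleftrightarrow> transpose X = X \<and> (\<forall>x. 0 \<le> x \<bullet> (X *v x))"

text \<open>
  Absolute continuity of a function on a compact interval. The members of a division are
  non-overlapping compact intervals \<open>k = [Inf k, Sup k]\<close>; their
  union \<open>U\<close> need not be all of \<open>[a, b]\<close>. (The library's \<open>absolutely_continuous\<close> is about measures.)
\<close>

definition abs_continuous_on_interval ::
    "real \<Rightarrow> real \<Rightarrow> (real \<Rightarrow> 'a::real_normed_vector) \<Rightarrow> bool" where
  "abs_continuous_on_interval a b f \<longleftrightarrow>
     (\<forall>\<epsilon>>0. \<exists>\<eta>>0. \<forall>d U. d division_of U \<and> U \<subseteq> {a..b} \<and> (\<Sum>k\<in>d. Sup k - Inf k) < \<eta>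
        \<longrightarrow> (\<Sum>k\<in>d. norm (f (Sup k) - f (Inf k))) < \<epsilon>)"

text \<open>The suffix \<open>b\<close> in a field name stands for the bar. The type \<open>real^'d^'n\<close> is that of
  \<open>n \<times> d\<close> matrices.\<close>

record ('n::finite, 'd::finite) riccati_coeffs =
  cA :: "real \<Rightarrow> real^'n^'n"
  cB :: "real \<Rightarrow> real^'n^'n"
  cBb :: "real \<Rightarrow> real^'n^'n"
  cC :: "real \<Rightarrow> real^'d^'n"
  cCb :: "real \<Rightarrow> real^'d^'n"
  cQ :: "real \<Rightarrow> real^'n^'n"
  cQb :: "real \<Rightarrow> real^'n^'n"
  cR :: "real \<Rightarrow> real^'n^'n"
  cRb :: "real \<Rightarrow> real^'n^'n"
  cN :: "real \<Rightarrow> real^'d^'d"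
  cNb :: "real \<Rightarrow> real^'d^'d"

definition bdd_meas_on :: "real \<Rightarrow> real set \<Rightarrow> (real \<Rightarrow> 'a::euclidean_space) \<Rightarrow> bool" where
  "bdd_meas_on K I f \<longleftrightarrow> f \<in> borel_measurable (lebesgue_on I) \<and> (\<forall>t\<in>I. norm (f t) \<le> K)"

text \<open>Each coefficient is constrained only on the interval of times at which it is evaluated:
  \<open>cQ\<close>, \<open>cR\<close>, \<open>cN\<close> at \<open>t\<close>, and \<open>cQb\<close>, \<open>cRb\<close>, \<open>cNb\<close> at \<open>t + \<delta>\<close>, for \<open>t\<close> in \<open>[s - \<delta>, T]\<close>.\<close>

definition admissible ::
    "real \<Rightarrow> real \<Rightarrow> real \<Rightarrow> real \<Rightarrow> real \<Rightarrow> ('n::finite, 'd::finite) riccati_coeffs \<Rightarrow> bool" where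
  "admissible K \<alpha> \<delta> s T D \<longleftrightarrow>
     bdd_meas_on K {s..T} (cA D) \<and> bdd_meas_on K {s..T} (cB D) \<and> bdd_meas_on K {s..T} (cBb D) \<and>
     bdd_meas_on K {s..T} (cC D) \<and> bdd_meas_on K {s..T} (cCb D) \<and>
     bdd_meas_on K {s-\<delta>..T} (cQ D) \<and> bdd_meas_on K {s..T+\<delta>} (cQb D) \<and>
     bdd_meas_on K {s-\<delta>..T} (cR D) \<and> bdd_meas_on K {s..T+\<delta>} (cRb D) \<and>
     bdd_meas_on K {s-\<delta>..T} (cN D) \<and> bdd_meas_on K {s..T+\<delta>} (cNb D) \<and>
     (\<forall>t\<in>{s-\<delta>..T}. transpose (cQ D t) = cQ D t \<and> transpose (cR D t) = cR D t
                   \<and> transpose (cN D t) = cN D t) \<and>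
     (\<forall>t\<in>{s..T+\<delta>}. transpose (cQb D t) = cQb D t \<and> transpose (cRb D t) = cRb D t
                   \<and> transpose (cNb D t) = cNb D t) \<and>
     (AE t\<in>{s-\<delta>..T} in lebesgue.
        psd (cQ D t + cQb D (t+\<delta>)) \<and>
        psd (cR D t + cRb D (t+\<delta>)) \<and>
        psd (cN D t + cNb D (t+\<delta>) - \<alpha> *\<^sub>R mat 1))"

definition calM ::
    "real \<Rightarrow> ('n::finite, 'd::finite) riccati_coeffs \<Rightarrow> (real \<Rightarrow> real^'n^'n) \<Rightarrow> real \<Rightarrow> real^'n^'n" where
  "calM \<delta> D S t = 2 *\<^sub>R (cR D t ** S t) + 2 *\<^sub>R (cRb D (t+\<delta>) ** S t) + mat 1"

definition calN :: "real \<Rightarrow> ('n::finite, 'd::finite) riccati_coeffs \<Rightarrow> real \<Rightarrow> real^'d^'d" where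
  "calN \<delta> D t = 2 *\<^sub>R cN D t + 2 *\<^sub>R cNb D (t+\<delta>)"

definition riccati_rhs ::
    "real \<Rightarrow> ('n::finite, 'd::finite) riccati_coeffs \<Rightarrow> (real \<Rightarrow> real^'n^'n) \<Rightarrow> real \<Rightarrow> real^'n^'n" where
  "riccati_rhs \<delta> D S t =
     - (S t ** transpose (cA D t)) - cA D t ** S t
     + 2 *\<^sub>R (S t ** (cQ D t + cQb D (t+\<delta>)) ** S t)
     - cB D t ** S t ** matrix_inv (calM \<delta> D S t) ** transpose (cB D t)
     - cC D t ** matrix_inv (calN \<delta> D t) ** transpose (cC D t)
     - cBb D t ** S (t-\<delta>) ** matrix_inv (calM \<delta> D S (t-\<delta>)) ** transpose (cBb D t)
     - cCb D t ** matrix_inv (calN \<delta> D (t-\<delta>)) ** transpose (cCb D t)"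

text \<open>The coefficients are only measurable in time, so the differential equation is understood in
  the sense of Caratheodory: \<open>S\<close> is absolutely continuous on \<open>[s, T]\<close> and satisfies it at almost every
  time. The values on \<open>[s - \<delta>, s)\<close> are prescribed and may jump at \<open>s\<close>, whence the one-sided
  derivative at the end points.\<close>

definition riccati_solution ::
    "real \<Rightarrow> real \<Rightarrow> real \<Rightarrow> ('n::finite, 'd::finite) riccati_coeffs \<Rightarrow> real^'n^'n
      \<Rightarrow> (real \<Rightarrow> real^'n^'n) \<Rightarrow> bool" where
  "riccati_solution \<delta> s T D M S \<longleftrightarrow>
     abs_continuous_on_interval s T S \<and>
     (AE t\<in>{s..T} in lebesgue. (S has_vector_derivative riccati_rhs \<delta> D S t) (at t within {s..T})) \<and>
     S T = M \<and> (\<forall>t\<in>{s-\<delta>..<s}. S t = mat 1)"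

definition C_psd :: "real \<Rightarrow> real \<Rightarrow> (real \<Rightarrow> real^'n^'n) set" where
  "C_psd s T = {S. continuous_on {s..T} S \<and> (\<forall>t\<in>{s..T}. psd (S t))}"

end

theory Submission
  imports Defs
begin

text \<open>
  In reversed time the quadratic term \<open>- 2 \<Sigma> (Q + Qb) \<Sigma>\<close> only decreases the trace of a positive semidefinite
  solution, and \<open>\<Sigma> \<M>\<^sup>-\<^sup>1\<close> is dominated by \<open>\<Sigma>\<close>; a Gronwall argument with delay therefore bounds every
  such solution in terms of the data alone. On bounded positive semidefinite matrices the
  right-hand side is Lipschitz in \<open>(\<Sigma>(t), \<Sigma>(t - \<delta>))\<close>, because the values \<open>Y\<^sub>i = \<Sigma>\<^sub>i \<M>\<^sub>i\<^sup>-\<^sup>1\<close> satisfy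
  \<open>Y\<^sub>1 - Y\<^sub>2 = \<M>\<^sub>1\<^sup>-\<^sup>T (\<Sigma>\<^sub>1 - \<Sigma>\<^sub>2) \<M>\<^sub>2\<^sup>-\<^sup>1\<close>. The same Gronwall argument, applied to the norm of the
  difference of two solutions, forces it to vanish. In both applications \<open>\<delta>\<close> has to be so small
  that the exponential weight grows at most by the factor 2 over one delay.
\<close>

section \<open>Absolutely continuous functions\<close>

lemma abs_continuous_on_intervalD:
  assumes "abs_continuous_on_interval a b f" "\<epsilon> > 0"
  obtains \<eta> where "\<eta> > 0" "\<And>d U. d division_of U \<Longrightarrow> U \<subseteq> {a..b} \<Longrightarrow> (\<Sum>k\<in>d. Sup k - Inf k) < \<eta>
        \<Longrightarrow> (\<Sum>k\<in>d. norm (f (Sup k) - f (Inf k))) < \<epsilon>"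
proof -
  obtain \<eta> where "\<eta> > 0" and \<eta>: "\<forall>d U. d division_of U \<and> U \<subseteq> {a..b} \<and> (\<Sum>k\<in>d. Sup k - Inf k) < \<eta>
        \<longrightarrow> (\<Sum>k\<in>d. norm (f (Sup k) - f (Inf k))) < \<epsilon>"
    using assms(1)[unfolded abs_continuous_on_interval_def, rule_format, OF assms(2)] by (elim exE conjE)
  show thesis
    by (rule that[OF \<open>\<eta> > 0\<close>], rule \<eta>[rule_format], intro conjI)
qed

lemma abs_continuous_on_interval_diff:
  assumes f: "abs_continuous_on_interval a b f" and g: "abs_continuous_on_interval a b g"
  shows "abs_continuous_on_interval a b (\<lambda>t. f t - g t)"
  unfolding abs_continuous_on_interval_def
proof (intro allI impI)
  fix \<epsilon> :: real
  assume "\<epsilon> > 0"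
  then have "\<epsilon>/2 > 0" by simp
  obtain \<eta> where \<eta>: "\<eta> > 0" "\<And>d U. d division_of U \<Longrightarrow> U \<subseteq> {a..b} \<Longrightarrow> (\<Sum>k\<in>d. Sup k - Inf k) < \<eta>
        \<Longrightarrow> (\<Sum>k\<in>d. norm (f (Sup k) - f (Inf k))) < \<epsilon>/2"
    by (rule abs_continuous_on_intervalD[OF f \<open>\<epsilon>/2 > 0\<close>]) (rule that, assumption, blast)
  obtain \<eta>' where \<eta>': "\<eta>' > 0" "\<And>d U. d division_of U \<Longrightarrow> U \<subseteq> {a..b} \<Longrightarrow> (\<Sum>k\<in>d. Sup k - Inf k) < \<eta>'
        \<Longrightarrow> (\<Sum>k\<in>d. norm (g (Sup k) - g (Inf k))) < \<epsilon>/2"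
    by (rule abs_continuous_on_intervalD[OF g \<open>\<epsilon>/2 > 0\<close>]) (rule that, assumption, blast)
  show "\<exists>\<eta>>0. \<forall>d U. d division_of U \<and> U \<subseteq> {a..b} \<and> (\<Sum>k\<in>d. Sup k - Inf k) < \<eta> \<longrightarrow>
     (\<Sum>k\<in>d. norm (f (Sup k) - g (Sup k) - (f (Inf k) - g (Inf k)))) < \<epsilon>"
  proof (intro exI[of _ "min \<eta> \<eta>'"] conjI allI impI; (elim conjE)?)
    show "min \<eta> \<eta>' > 0" using \<eta> \<eta>' by simp
    fix d U
    assume d: "d division_of U" "U \<subseteq> {a..b}" "(\<Sum>k\<in>d. Sup k - Inf k) < min \<eta> \<eta>'"
    have "(\<Sum>k\<in>d. norm (f (Sup k) - g (Sup k) - (f (Inf k) - g (Inf k))))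
        \<le> (\<Sum>k\<in>d. norm (f (Sup k) - f (Inf k)) + norm (g (Sup k) - g (Inf k)))"
    proof (rule sum_mono)
      fix k
      show "norm (f (Sup k) - g (Sup k) - (f (Inf k) - g (Inf k)))
          \<le> norm (f (Sup k) - f (Inf k)) + norm (g (Sup k) - g (Inf k))"
        using norm_triangle_ineq4[of "f (Sup k) - f (Inf k)" "g (Sup k) - g (Inf k)"]
        by (simp add: algebra_simps)
    qed
    also have "\<dots> < \<epsilon>/2 + \<epsilon>/2"
      unfolding sum.distrib using \<eta>(2)[OF d(1,2)] \<eta>'(2)[OF d(1,2)] d(3) by (intro add_strict_mono) auto
    finally show "(\<Sum>k\<in>d. norm (f (Sup k) - g (Sup k) - (f (Inf k) - g (Inf k)))) < \<epsilon>" by simp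
  qed
qed

text \<open>Reduces matrix-valued functions to scalar ones: \<open>L\<close> will be the trace or
  the inner product with a fixed matrix.\<close>

lemma abs_continuous_on_interval_bounded_linear:
  assumes L: "bounded_linear L" and f: "abs_continuous_on_interval a b f"
  shows "abs_continuous_on_interval a b (\<lambda>t. L (f t))"
  unfolding abs_continuous_on_interval_def
proof (intro allI impI)
  fix \<epsilon> :: real
  assume "\<epsilon> > 0"
  obtain B where B: "B > 0" "\<And>x. norm (L x) \<le> norm x * B"
    using bounded_linear.pos_bounded[OF L] by blast
  have "\<epsilon>/B > 0" using \<open>\<epsilon> > 0\<close> B by simp
  obtain \<eta> where \<eta>: "\<eta> > 0" "\<And>d U. d division_of U \<Longrightarrow> U \<subseteq> {a..b} \<Longrightarrow> (\<Sum>k\<in>d. Sup k - Inf k) < \<eta>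
        \<Longrightarrow> (\<Sum>k\<in>d. norm (f (Sup k) - f (Inf k))) < \<epsilon>/B"
    by (rule abs_continuous_on_intervalD[OF f \<open>\<epsilon>/B > 0\<close>]) (rule that, assumption, blast)
  show "\<exists>\<eta>>0. \<forall>d U. d division_of U \<and> U \<subseteq> {a..b} \<and> (\<Sum>k\<in>d. Sup k - Inf k) < \<eta> \<longrightarrow>
     (\<Sum>k\<in>d. norm (L (f (Sup k)) - L (f (Inf k)))) < \<epsilon>"
  proof (intro exI[of _ \<eta>] conjI allI impI \<eta>(1); elim conjE)
    fix d U
    assume d: "d division_of U" "U \<subseteq> {a..b}" "(\<Sum>k\<in>d. Sup k - Inf k) < \<eta>"
    have "(\<Sum>k\<in>d. norm (L (f (Sup k)) - L (f (Inf k)))) \<le> (\<Sum>k\<in>d. norm (f (Sup k) - f (Inf k)) * B)"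
      using B(2) by (intro sum_mono) (metis L bounded_linear.linear linear_diff)
    also have "\<dots> < \<epsilon>/B * B"
      unfolding sum_distrib_right[symmetric] using \<eta>(2)[OF d] B(1) by (intro mult_strict_right_mono)
    finally show "(\<Sum>k\<in>d. norm (L (f (Sup k)) - L (f (Inf k)))) < \<epsilon>" using B(1) by simp
  qed
qed

lemma division_of_real_memberE:
  fixes d :: "real set set"
  assumes "d division_of U" "k \<in> d"
  obtains u v where "k = {u..v}" "u \<le> v" "Inf k = u" "Sup k = v"
proof -
  obtain u v where "k = cbox u v" "k \<noteq> {}" using division_ofD(3,4)[OF assms] by blast
  then show thesis using that[of u v] by auto
qed

text \<open>Supplies the absolute continuity of the explicit comparison function in the Gronwall
  argument.\<close>

lemma lipschitz_imp_abs_continuous_on_interval: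
  assumes f: "C-lipschitz_on {a..b} f"
  shows "abs_continuous_on_interval a b f"
  unfolding abs_continuous_on_interval_def
proof (intro allI impI)
  fix \<epsilon> :: real
  assume "\<epsilon> > 0"
  have C: "C \<ge> 0" using f lipschitz_on_nonneg by blast
  show "\<exists>\<eta>>0. \<forall>d U. d division_of U \<and> U \<subseteq> {a..b} \<and> (\<Sum>k\<in>d. Sup k - Inf k) < \<eta> \<longrightarrow>
     (\<Sum>k\<in>d. norm (f (Sup k) - f (Inf k))) < \<epsilon>"
  \<comment> \<open>\<open>C + 1\<close> in place of \<open>C\<close> keeps the quotient meaningful
    and the estimate strict when \<open>C = 0\<close>.\<close>
  proof (intro exI[of _ "\<epsilon>/(C+1)"] conjI allI impI; (elim conjE)?)
    show "\<epsilon>/(C+1) > 0" using \<open>\<epsilon> > 0\<close> C by simp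
    fix d U
    assume d: "d division_of U" "U \<subseteq> {a..b}" "(\<Sum>k\<in>d. Sup k - Inf k) < \<epsilon>/(C+1)"
    have "(\<Sum>k\<in>d. norm (f (Sup k) - f (Inf k))) \<le> (\<Sum>k\<in>d. (C+1) * (Sup k - Inf k))"
    proof (rule sum_mono)
      fix k assume k: "k \<in> d"
      then obtain u v where uv: "k = {u..v}" "u \<le> v" "Inf k = u" "Sup k = v"
        using division_of_real_memberE[OF d(1)] by blast
      have "k \<subseteq> {a..b}" using division_ofD(2)[OF d(1) k] d(2) by blast
      then have "norm (f v - f u) \<le> C * (v - u)"
        using lipschitz_onD[OF f, of v u] uv by (simp add: dist_norm)
      also have "\<dots> \<le> (C+1) * (v - u)" using uv by (intro mult_right_mono) auto
      finally show "norm (f (Sup k) - f (Inf k)) \<le> (C+1) * (Sup k - Inf k)" using uv by simp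
    qed
    also have "\<dots> < (C+1) * (\<epsilon>/(C+1))"
      unfolding sum_distrib_left[symmetric] using d(3) C by (intro mult_strict_left_mono) auto
    finally show "(\<Sum>k\<in>d. norm (f (Sup k) - f (Inf k))) < \<epsilon>" using C by simp
  qed
qed

section \<open>Monotonicity from the sign of the derivative almost everywhere\<close>

text \<open>
  On a tagged division fine for a suitable gauge, the intervals tagged outside the exceptional null
  set contribute almost nonnegative increments by differentiability; those tagged inside it lie in
  an open set of small measure and are controlled by absolute continuity.
\<close>

lemma abs_continuous_on_interval_derivative_nonneg_imp_le:
  fixes f :: "real \<Rightarrow> real"
  assumes ac: "abs_continuous_on_interval a b f"
    and deriv: "AE t\<in>{a..b} in lebesgue. \<exists>f'\<ge>0. (f has_vector_derivative f') (at t within {a..b})"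
    and uv: "a \<le> u" "u \<le> v" "v \<le> b"
  shows "f u \<le> f v"
proof -
  obtain E where E: "negligible E" and
    good: "\<And>t. t \<in> {a..b} \<Longrightarrow> t \<notin> E \<Longrightarrow> \<exists>f'\<ge>0. (f has_vector_derivative f') (at t within {a..b})"
    using deriv unfolding eventually_ae_filter_negligible by blast
  \<comment> \<open>The loss \<open>\<epsilon> * (v - u)\<close> comes from the intervals with tags
    outside \<open>E\<close>, the additional \<open>\<epsilon>\<close> from those with tags in
    \<open>E\<close>.\<close>
  have main: "- \<epsilon> * (v - u + 1) \<le> f v - f u" if "\<epsilon> > 0" for \<epsilon>
  proof -
    obtain \<eta> where \<eta>: "\<eta> > 0" "\<And>d U. d division_of U \<Longrightarrow> U \<subseteq> {a..b} \<Longrightarrow> (\<Sum>k\<in>d. Sup k - Inf k) < \<eta>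
        \<Longrightarrow> (\<Sum>k\<in>d. norm (f (Sup k) - f (Inf k))) < \<epsilon>"
      by (rule abs_continuous_on_intervalD[OF ac \<open>\<epsilon> > 0\<close>]) (rule that, assumption, blast)
    have E0: "E \<in> lmeasurable" "measure lebesgue E = 0"
      using E by (auto simp: negligible_iff_measure)
    \<comment> \<open>An open neighbourhood of the null set whose measure is below the modulus
      \<open>\<eta>\<close> of absolute continuity; as \<open>E\<close> is null, it is enough to
      bound \<open>V - E\<close>.\<close>
    obtain V where V0: "open V" "E \<subseteq> V" "V - E \<in> lmeasurable" "emeasure lebesgue (V - E) < ennreal \<eta>"
      using sets_lebesgue_outer_open[OF fmeasurableD[OF E0(1)] \<eta>(1)] by blast
    have "measure lebesgue (V - E) < \<eta>"
      using V0(3,4) \<eta>(1) by (simp add: emeasure_eq_measure2 ennreal_less_iff)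
    moreover have "V = (V - E) \<union> E" using V0(2) by blast
    ultimately have V: "open V" "E \<subseteq> V" "V \<in> lmeasurable" "measure lebesgue V < \<eta>"
      using V0 E0 fmeasurable.Un[OF V0(3) E0(1)] measure_Un_le[OF fmeasurableD[OF V0(3)] fmeasurableD[OF E0(1)]]
      by auto
    \<comment> \<open>The increment is estimated on both sides of \<open>t\<close>, because a tag
      lies anywhere in its interval and the interval will be split there.\<close>
    have "\<exists>r>0. \<forall>y\<in>{a..b}. \<bar>y - t\<bar> < r \<longrightarrow> (t \<le> y \<longrightarrow> - \<epsilon> * (y - t) \<le> f y - f t) \<and>
        (y \<le> t \<longrightarrow> - \<epsilon> * (t - y) \<le> f t - f y)" if t: "t \<in> {a..b} - E" for t
    proof -
      obtain f' where f': "f' \<ge> 0" "(f has_vector_derivative f') (at t within {a..b})"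
        using good t by auto
      have "(f has_derivative (\<lambda>h. h *\<^sub>R f')) (at t within {a..b})"
        using f'(2) by (simp add: has_vector_derivative_def)
      then obtain r where r: "r > 0"
        "\<And>y. y\<in>{a..b} \<Longrightarrow> norm (y - t) < r \<Longrightarrow> norm (f y - f t - (y - t) *\<^sub>R f') \<le> \<epsilon> * norm (y - t)"
        using \<open>\<epsilon> > 0\<close> unfolding has_derivative_within_alt by blast
      show ?thesis
      proof (intro exI[of _ r] conjI r(1) ballI impI)
        fix y assume y: "y \<in> {a..b}" "\<bar>y - t\<bar> < r"
        have *: "\<bar>f y - f t - (y - t) * f'\<bar> \<le> \<epsilon> * \<bar>y - t\<bar>" using r(2)[OF y(1)] y(2) by simp
        show "- \<epsilon> * (y - t) \<le> f y - f t" if "t \<le> y"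
        proof -
          have "(y - t) * f' \<ge> 0" using that f'(1) by simp
          moreover have "\<bar>y - t\<bar> = y - t" using that by simp
          ultimately show ?thesis using * by (simp add: abs_le_iff)
        qed
        show "- \<epsilon> * (t - y) \<le> f t - f y" if "y \<le> t"
        proof -
          have "(t - y) * f' \<ge> 0" using that f'(1) by simp
          then have "(y - t) * f' \<le> 0" by (simp add: algebra_simps)
          moreover have "\<bar>y - t\<bar> = t - y" using that by simp
          ultimately show ?thesis using * by (simp add: abs_le_iff)
        qed
      qed
    qed
    then obtain r where r: "\<And>t. t \<in> {a..b} - E \<Longrightarrow> r t > 0"
      "\<And>t y. t \<in> {a..b} - E \<Longrightarrow> y \<in> {a..b} \<Longrightarrow> \<bar>y - t\<bar> < r t \<Longrightarrow> t \<le> y \<Longrightarrow> - \<epsilon> * (y - t) \<le> f y - f t"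
      "\<And>t y. t \<in> {a..b} - E \<Longrightarrow> y \<in> {a..b} \<Longrightarrow> \<bar>y - t\<bar> < r t \<Longrightarrow> y \<le> t \<Longrightarrow> - \<epsilon> * (t - y) \<le> f t - f y"
      by metis
    \<comment> \<open>All intervals tagged in \<open>E\<close> are forced into the one open set
      \<open>V\<close>. Off \<open>{a..b}\<close>, where no tag lies, \<open>UNIV\<close> is a
      default.\<close>
    define \<gamma> where "\<gamma> t = (if t \<in> E then V else if t \<in> {a..b} then ball t (r t) else UNIV)" for t
    have "gauge \<gamma>"
      unfolding gauge_def \<gamma>_def using V r(1) by auto
    then obtain p where p: "p tagged_division_of {u..v}" "\<gamma> fine p"
      using fine_division_exists_real by blast
    have fin: "finite p" using p(1) by blast
    define p1 where "p1 = {(x, k) \<in> p. x \<in> E}"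
    define p2 where "p2 = {(x, k) \<in> p. x \<notin> E}"
    have split: "sum g p = sum g p1 + sum g p2" for g :: "real \<times> real set \<Rightarrow> real"
    proof -
      have "p = p1 \<union> p2" "p1 \<inter> p2 = {}" by (auto simp: p1_def p2_def)
      then show ?thesis using fin by (metis finite_Un sum.union_disjoint)
    qed
    have sub: "{u..v} \<subseteq> {a..b}" using uv by auto
    have "p1 tagged_division_of \<Union>(snd ` p1)"
      by (rule tagged_partial_division_of_Union_self[OF tagged_partial_division_subset])
         (use p(1) in \<open>auto simp: tagged_division_of_def p1_def\<close>)
    note td1 = this
    note d1 = division_of_tagged_division[OF td1]
    have le1: "- \<epsilon> \<le> (\<Sum>(x, k)\<in>p1. f (Sup k) - f (Inf k))"
    proof -
      have "\<Union>(snd ` p1) \<subseteq> V"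
        using fineD[OF p(2)] by (force simp: p1_def \<gamma>_def)
      have in_ab: "\<Union>(snd ` p1) \<subseteq> {a..b}"
      proof -
        have "k \<subseteq> {u..v}" if "(x, k) \<in> p" for x k using tagged_division_ofD(3)[OF p(1) that] .
        then show ?thesis using sub by (fastforce simp: p1_def)
      qed
      have "(\<Sum>k\<in>snd ` p1. Sup k - Inf k) = (\<Sum>k\<in>snd ` p1. measure lebesgue k)"
      proof (rule sum.cong[OF refl])
        fix k assume "k \<in> snd ` p1"
        then obtain x y where "k = {x..y}" "x \<le> y" "Inf k = x" "Sup k = y"
          using division_of_real_memberE[OF d1] by blast
        then show "Sup k - Inf k = measure lebesgue k" by simp
      qed
      also have "\<dots> = measure lebesgue (\<Union>(snd ` p1))" by (rule content_division[OF d1])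
      also have "\<dots> \<le> measure lebesgue V"
        using \<open>\<Union>(snd ` p1) \<subseteq> V\<close> V(3) lmeasurable_division[OF d1] by (intro measure_mono_fmeasurable) auto
      finally have "(\<Sum>k\<in>snd ` p1. norm (f (Sup k) - f (Inf k))) < \<epsilon>"
        using \<eta>(2)[OF d1 in_ab] V(4) by simp
      moreover have "\<bar>\<Sum>k\<in>snd ` p1. f (Sup k) - f (Inf k)\<bar> \<le> (\<Sum>k\<in>snd ` p1. norm (f (Sup k) - f (Inf k)))"
        by simp
      moreover have "(\<Sum>(x, k)\<in>p1. f (Sup k) - f (Inf k)) = (\<Sum>k\<in>snd ` p1. f (Sup k) - f (Inf k))"
      proof -
        \<comment> \<open>One interval can carry several tags only if it is degenerate, and then it
          contributes 0. The empty set gets the value 0 explicitly, since its \<open>Inf\<close> and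
          \<open>Sup\<close> are not endpoints.\<close>
        let ?g = "\<lambda>k. if k = {} then 0 else f (Sup k) - f (Inf k)"
        have "(\<Sum>(x, k)\<in>p1. f (Sup k) - f (Inf k)) = (\<Sum>(x, k)\<in>p1. ?g k)"
          using tagged_division_ofD(2)[OF td1] by (intro sum.cong) fastforce+
        also have "\<dots> = sum ?g (snd ` p1)"
        proof (rule sum.over_tagged_division_lemma[OF td1])
          fix x y :: real
          assume "box x y = {}"
          then have "y \<le> x" by (simp add: box_real)
          then show "?g (cbox x y) = 0" by (cases "x = y") auto
        qed
        also have "\<dots> = (\<Sum>k\<in>snd ` p1. f (Sup k) - f (Inf k))"
          using division_ofD(3)[OF d1] by (intro sum.cong) auto
        finally show ?thesis .
      qed
      ultimately show ?thesis by linarith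
    qed
    have le2: "- \<epsilon> * (v - u) \<le> (\<Sum>(x, k)\<in>p2. f (Sup k) - f (Inf k))"
    proof -
      have p2E: "\<exists>c d. k = {c..d} \<and> x \<in> {c..d} \<and> c \<in> {a..b} \<and> d \<in> {a..b} \<and> x \<in> {a..b} - E \<and> \<bar>c - x\<bar> < r x \<and> \<bar>d - x\<bar> < r x"
        if "(x, k) \<in> p2" for x k
      proof -
        have xk: "(x, k) \<in> p" "x \<notin> E" using that by (auto simp: p2_def)
        obtain c d where k: "k = {c..d}" using tagged_division_ofD(4)[OF p(1) xk(1)] by auto
        have x: "x \<in> k" "k \<subseteq> {a..b}"
          using tagged_division_ofD(2,3)[OF p(1) xk(1)] sub by auto
        have "x \<in> {a..b}" using x by blast
        then have "k \<subseteq> ball x (r x)" using fineD[OF p(2) xk(1)] xk(2) by (simp add: \<gamma>_def)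
        moreover have "c \<in> k" "d \<in> k" using k x by auto
        ultimately have "c \<in> ball x (r x)" "d \<in> ball x (r x)" by blast+
        then show ?thesis using k x xk(2) by (auto simp: dist_real_def)
      qed
      have "(\<Sum>(x, k)\<in>p1. Sup k - Inf k) \<ge> 0"
      proof (rule sum_nonneg, clarify)
        fix x k assume "(x, k) \<in> p1"
        then have "k \<in> snd ` p1" by force
        then show "0 \<le> Sup k - Inf k" using division_of_real_memberE[OF d1] by (metis diff_ge_0_iff_ge)
      qed
      moreover have "(\<Sum>(x, k)\<in>p. Sup k - Inf k) = v - u"
        using additive_tagged_division_1[OF uv(2) p(1), of "\<lambda>x. x"] .
      ultimately have "(\<Sum>(x, k)\<in>p2. Sup k - Inf k) \<le> v - u"
        using split[of "\<lambda>(x, k). Sup k - Inf k"] by linarith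
      then have "- \<epsilon> * (v - u) \<le> - \<epsilon> * (\<Sum>(x, k)\<in>p2. Sup k - Inf k)"
        using \<open>\<epsilon> > 0\<close> by simp
      also have "\<dots> = (\<Sum>(x, k)\<in>p2. - \<epsilon> * (Sup k - Inf k))"
        unfolding sum_distrib_left by (simp add: case_prod_unfold)
      also have "\<dots> \<le> (\<Sum>(x, k)\<in>p2. f (Sup k) - f (Inf k))"
      proof (rule sum_mono, clarify)
        fix x k assume "(x, k) \<in> p2"
        then obtain c d where k: "k = {c..d}" "x \<in> {c..d}" "c \<in> {a..b}" "d \<in> {a..b}" "x \<in> {a..b} - E"
          "\<bar>c - x\<bar> < r x" "\<bar>d - x\<bar> < r x"
          using p2E by blast
        \<comment> \<open>Both estimates are anchored at the tag \<open>x\<close>, so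
          \<open>f x\<close> cancels in their sum.\<close>
        have "- \<epsilon> * (d - x) \<le> f d - f x" "- \<epsilon> * (x - c) \<le> f x - f c"
          using r(2)[OF k(5) k(4) k(7)] r(3)[OF k(5) k(3) k(6)] k(2) by auto
        then have "- \<epsilon> * (d - c) \<le> f d - f c" by (simp add: algebra_simps)
        then show "- \<epsilon> * (Sup k - Inf k) \<le> f (Sup k) - f (Inf k)" using k(1,2) by simp
      qed
      finally show ?thesis .
    qed
    have "f v - f u = (\<Sum>(x, k)\<in>p. f (Sup k) - f (Inf k))"
      using additive_tagged_division_1[OF uv(2) p(1), of f] by simp
    then show ?thesis
      using le1 le2 split[of "\<lambda>(x, k). f (Sup k) - f (Inf k)"] by (simp add: algebra_simps)
  qed
  show ?thesis
  proof (rule field_le_epsilon)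
    fix \<epsilon> :: real
    assume "\<epsilon> > 0"
    then have "- (\<epsilon> / (v - u + 1)) * (v - u + 1) \<le> f v - f u"
      using uv by (intro main) simp
    then show "f u \<le> f v + \<epsilon>" using uv by simp
  qed
qed

section \<open>A backward Gronwall inequality with delay\<close>

text \<open>
  Compares \<open>p\<close> with the multiple \<open>q\<close> of \<open>exp (\<mu> (T - t))\<close> that touches it from above on \<open>[s, T]\<close>. The
  majorant \<open>h\<close> may depend on the point \<open>t0\<close>, so that \<open>p\<close> can be a norm, which need not be differentiable.
\<close>

lemma delayed_gronwall_backward:
  fixes p :: "real \<Rightarrow> real"
  assumes "s \<le> T" "0 \<le> \<delta>"
    and nn: "0 \<le> a" "0 \<le> b" "0 \<le> c" "0 \<le> P"
    and cont: "continuous_on {s..T} p"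
    and p0: "\<And>t. t \<in> {s..T} \<Longrightarrow> 0 \<le> p t"
    and hist: "\<And>t. t \<in> {s-\<delta>..<s} \<Longrightarrow> p t \<le> P"
    and small: "exp (2 * (a + 2 * b + 1) * \<delta>) \<le> 2"
    and dom: "\<And>t0. t0 \<in> {s..T} \<Longrightarrow> \<exists>h. abs_continuous_on_interval s T h \<and> p t0 \<le> h t0 \<and> h T \<le> H \<and>
        (AE t\<in>{s..T} in lebesgue. \<exists>h'. (h has_vector_derivative h') (at t within {s..T}) \<and>
           - h' \<le> a * p t + b * p (t - \<delta>) + c)"
    and "t \<in> {s..T}"
  shows "p t \<le> 2 * (H + (b * P + c) * (T - s)) * exp (2 * (a + 2 * b + 1) * (T - s))"
proof -
  \<comment> \<open>The term \<open>2 * b\<close> pays for the factor 2 that the weight may gain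
    over one delay, the 1 makes \<open>\<mu>\<close> positive and leaves a surplus
    \<open>q * e t\<close>, and the outer 2 compensates the half in \<open>G\<close>.\<close>
  define \<mu> where "\<mu> = 2 * (a + 2 * b + 1)"
  define e where "e t = exp (\<mu> * (T - t))" for t
  define k where "k = b * P + c"
  have \<mu>: "\<mu> > 0" and k: "k \<ge> 0" using nn by (auto simp: \<mu>_def k_def)
  have e_pos: "e t > 0" for t by (simp add: e_def)
  have "continuous_on {s..T} (\<lambda>t. p t / e t)"
    unfolding e_def by (intro continuous_intros cont) auto
  then obtain t0 where t0: "t0 \<in> {s..T}" "\<And>t. t \<in> {s..T} \<Longrightarrow> p t / e t \<le> p t0 / e t0"
    using continuous_attains_sup[of "{s..T}" "\<lambda>t. p t / e t"] \<open>s \<le> T\<close> by auto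
  define q where "q = p t0 / e t0"
  have q: "q \<ge> 0" using p0[OF t0(1)] e_pos[of t0] by (simp add: q_def)
  have p_le: "p t \<le> q * e t" if "t \<in> {s..T}" for t
    using t0(2)[OF that] e_pos[of t] by (simp add: q_def field_simps)
  obtain h where h: "abs_continuous_on_interval s T h" "p t0 \<le> h t0" "h T \<le> H"
    and h': "AE t\<in>{s..T} in lebesgue. \<exists>h'. (h has_vector_derivative h') (at t within {s..T}) \<and>
           - h' \<le> a * p t + b * p (t - \<delta>) + c"
    using dom[OF t0(1)] by blast
  \<comment> \<open>Only half of the touching multiple is used: at \<open>t0\<close> the other half
    of \<open>p t0 = q * e t0\<close> remains and is bounded by the data. The linear part absorbs
    the history bound and \<open>c\<close>.\<close>
  define G where "G t = q / 2 * e t + k * (T - t)" for t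
  have G': "(G has_vector_derivative (- (\<mu> * q / 2 * e t) - k)) (at t within X)" for t X
    unfolding G_def e_def by (auto intro!: derivative_eq_intros simp: has_real_derivative_iff_has_vector_derivative[symmetric])
  have "(\<mu> * q / 2 * e s + k)-lipschitz_on {s..T} G"
  proof (rule bounded_derivative_imp_lipschitz)
    fix t assume t: "t \<in> {s..T}"
    show "(G has_derivative (\<lambda>h. h *\<^sub>R (- (\<mu> * q / 2 * e t) - k))) (at t within {s..T})"
      using G' by (simp add: has_vector_derivative_def)
    have "e t \<le> e s" using t \<mu> by (simp add: e_def)
    then have "\<mu> * q / 2 * e t \<le> \<mu> * q / 2 * e s" using \<mu> q by (intro mult_left_mono) auto
    moreover have "\<mu> * q / 2 * e t \<ge> 0" using \<mu> q e_pos[of t] by simp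
    ultimately have "\<bar>- (\<mu> * q / 2 * e t) - k\<bar> \<le> \<mu> * q / 2 * e s + k" using k by linarith
    then show "onorm (\<lambda>h. h *\<^sub>R (- (\<mu> * q / 2 * e t) - k)) \<le> \<mu> * q / 2 * e s + k"
      by (intro onorm_le) (simp add: abs_mult mult.commute mult_left_mono)
  next
    show "0 \<le> \<mu> * q / 2 * e s + k" using \<mu> q k e_pos[of s] by simp
  qed simp
  then have "abs_continuous_on_interval s T (\<lambda>t. h t - G t)"
    by (intro abs_continuous_on_interval_diff h(1) lipschitz_imp_abs_continuous_on_interval)
  moreover have "AE t\<in>{s..T} in lebesgue. \<exists>f'\<ge>0. ((\<lambda>t. h t - G t) has_vector_derivative f') (at t within {s..T})"
    using h'
  proof (eventually_elim, intro impI)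
    fix t assume "t \<in> {s..T} \<longrightarrow> (\<exists>h'. (h has_vector_derivative h') (at t within {s..T}) \<and>
           - h' \<le> a * p t + b * p (t - \<delta>) + c)" and t: "t \<in> {s..T}"
    then obtain h' where h': "(h has_vector_derivative h') (at t within {s..T})"
      "- h' \<le> a * p t + b * p (t - \<delta>) + c" by blast
    \<comment> \<open>One bound for both cases: \<open>P\<close> covers the times before
      \<open>s\<close>, and the weight together with the smallness of \<open>\<delta>\<close> covers
      the later ones.\<close>
    have "p (t - \<delta>) \<le> 2 * q * e t + P"
    proof (cases "t - \<delta> < s")
      case True
      then have "p (t - \<delta>) \<le> P" using t by (intro hist) auto
      moreover have "0 \<le> 2 * q * e t" using q e_pos[of t] by simp
      ultimately show ?thesis by linarith
    next
      case False
      then have "p (t - \<delta>) \<le> q * e (t - \<delta>)" using t \<open>0 \<le> \<delta>\<close> by (intro p_le) auto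
      also have "e (t - \<delta>) = e t * exp (\<mu> * \<delta>)" by (simp add: e_def exp_add[symmetric] algebra_simps)
      also have "q * (e t * exp (\<mu> * \<delta>)) \<le> q * (e t * 2)"
        using small q e_pos[of t] by (intro mult_left_mono) (auto simp: \<mu>_def)
      finally show ?thesis using nn(4) by simp
    qed
    then have "b * p (t - \<delta>) \<le> b * (2 * q * e t + P)" using nn(2) by (rule mult_left_mono)
    moreover have "a * p t \<le> a * (q * e t)" using p_le[OF t] nn(1) by (rule mult_left_mono)
    moreover have "a * (q * e t) + b * (2 * q * e t + P) + c = \<mu> * q / 2 * e t + k - q * e t"
      by (simp add: \<mu>_def k_def field_simps)
    moreover have "0 \<le> q * e t" using q e_pos[of t] by simp
    ultimately have "0 \<le> h' - (- (\<mu> * q / 2 * e t) - k)" using h'(2) by linarith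
    moreover have "((\<lambda>t. h t - G t) has_vector_derivative (h' - (- (\<mu> * q / 2 * e t) - k))) (at t within {s..T})"
      by (intro has_vector_derivative_diff h'(1) G')
    ultimately show "\<exists>f'\<ge>0. ((\<lambda>t. h t - G t) has_vector_derivative f') (at t within {s..T})" by blast
  qed
  \<comment> \<open>\<open>h - G\<close> is nondecreasing, so the terminal values control it at
    \<open>t0\<close>.\<close>
  ultimately have "h t0 - G t0 \<le> h T - G T"
    by (rule abs_continuous_on_interval_derivative_nonneg_imp_le) (use t0(1) in auto)
  moreover have "G T = q / 2" "G t0 = q / 2 * e t0 + k * (T - t0)" by (simp_all add: G_def e_def)
  moreover have "p t0 = q * e t0" using e_pos[of t0] by (simp add: q_def)
  moreover have "k * (T - t0) \<le> k * (T - s)" using k t0(1) by (intro mult_left_mono) auto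
  ultimately have "q / 2 * e t0 \<le> H + k * (T - s)"
    using h(2,3) q by linarith
  moreover have "q / 2 * 1 \<le> q / 2 * e t0"
    using q t0(1) \<mu> by (intro mult_left_mono) (auto simp: e_def)
  ultimately have q_le: "q \<le> 2 * (H + k * (T - s))" by simp
  have "e t \<le> e s" using \<open>t \<in> {s..T}\<close> \<mu> by (simp add: e_def)
  have "p t \<le> q * e t" using \<open>t \<in> {s..T}\<close> by (rule p_le)
  also have "\<dots> \<le> q * e s" using \<open>e t \<le> e s\<close> q by (rule mult_left_mono)
  also have "\<dots> \<le> 2 * (H + k * (T - s)) * e s" using q_le e_pos[of s] by (intro mult_right_mono) auto
  finally show ?thesis by (simp add: k_def e_def \<mu>_def)
qed

section \<open>Positive semidefinite matrices\<close>

lemma norm_matrix_vector_mult_le: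
  fixes A :: "real^'m^'n"
  shows "norm (A *v x) \<le> norm A * norm x"
proof -
  have "norm (A *v x) = L2_set (\<lambda>i. norm ((A *v x) $ i)) UNIV" by (simp add: norm_vec_def)
  also have "\<dots> \<le> L2_set (\<lambda>i. norm (A $ i) * norm x) UNIV"
    by (intro L2_set_mono) (simp_all add: matrix_vector_mul_component Cauchy_Schwarz_ineq2)
  also have "\<dots> = norm A * norm x" by (simp add: L2_set_left_distrib norm_vec_def[of A])
  finally show ?thesis .
qed

lemma norm_matrix_power2:
  fixes A :: "real^'m^'n"
  shows "(norm A)\<^sup>2 = (\<Sum>i\<in>UNIV. \<Sum>j\<in>UNIV. (A $ i $ j)\<^sup>2)"
  by (simp add: norm_vec_def L2_set_def sum_nonneg)

lemma norm_transpose: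
  fixes A :: "real^'m^'n"
  shows "norm (transpose A) = norm A"
proof -
  have "(norm (transpose A))\<^sup>2 = (norm A)\<^sup>2"
    unfolding norm_matrix_power2 by (subst sum.swap) (simp add: transpose_def)
  then show ?thesis by simp
qed

text \<open>Each row of the product is the transpose of \<open>B\<close> applied to a row of
  \<open>A\<close>, which reduces the claim to the estimate for vectors.\<close>

lemma norm_matrix_mult_le:
  fixes A :: "real^'m^'n" and B :: "real^'k^'m"
  shows "norm (A ** B) \<le> norm A * norm B"
proof -
  have row: "(A ** B) $ i = transpose B *v (A $ i)" for i
    by (simp add: vec_eq_iff matrix_matrix_mult_def matrix_vector_mult_def transpose_def mult.commute)
  have "norm (A ** B) = L2_set (\<lambda>i. norm ((A ** B) $ i)) UNIV" by (simp add: norm_vec_def)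
  also have "\<dots> \<le> L2_set (\<lambda>i. norm (A $ i) * norm B) UNIV"
  proof (rule L2_set_mono)
    show "norm ((A ** B) $ i) \<le> norm (A $ i) * norm B" for i
      using norm_matrix_vector_mult_le[of "transpose B" "A $ i"]
      unfolding row norm_transpose by (simp only: mult.commute)
  qed simp
  also have "\<dots> = norm A * norm B" by (simp add: L2_set_left_distrib norm_vec_def[of A])
  finally show ?thesis .
qed

text \<open>The columns of \<open>A\<close> are the images of the unit vectors, and the Frobenius
  norm is at most the sum of the column norms. The dimension is the price for passing from an
  operator bound to this norm.\<close>

lemma norm_matrix_le_operator_bound:
  fixes A :: "real^'m^'n"
  assumes "\<And>x. norm (A *v x) \<le> c * norm x"
  shows "norm A \<le> real CARD('m) * c"
proof -
  have "norm A = norm (transpose A)" by (simp add: norm_transpose)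
  also have "\<dots> \<le> (\<Sum>j\<in>UNIV. norm (transpose A $ j))"
    unfolding norm_vec_def[of "transpose A"] by (intro L2_set_le_sum) simp
  also have "\<dots> \<le> (\<Sum>j\<in>(UNIV::'m set). c)"
  proof (rule sum_mono)
    fix j
    have "transpose A $ j = A *v axis j 1"
      by (simp add: matrix_vector_mult_basis column_def transpose_def vec_eq_iff)
    then show "norm (transpose A $ j) \<le> c" using assms[of "axis j 1"] by simp
  qed
  finally show ?thesis by simp
qed

lemma abs_trace_le:
  fixes A :: "real^'n^'n"
  shows "\<bar>trace A\<bar> \<le> real CARD('n) * norm A"
proof -
  have "\<bar>trace A\<bar> \<le> (\<Sum>i\<in>UNIV. \<bar>A $ i $ i\<bar>)" unfolding trace_def by (rule sum_abs)
  also have "\<dots> \<le> (\<Sum>i\<in>(UNIV::'n set). norm A)"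
    by (intro sum_mono) (metis Finite_Cartesian_Product.norm_nth_le order_trans real_norm_def)
  finally show ?thesis by simp
qed

lemma trace_scaleR: "trace (c *\<^sub>R A) = c * trace (A :: real^'n^'n)"
  by (simp add: trace_def sum_distrib_left)

lemma bounded_linear_trace: "bounded_linear (trace :: real^'n^'n \<Rightarrow> real)"
  unfolding linear_conv_bounded_linear[symmetric]
  by (rule linearI) (simp_all add: trace_add trace_scaleR)

section \<open>Positive semidefinite forms and the inverses built from them\<close>

lemma symmetric_inner_matrix_vector:
  fixes S :: "real^'n^'n"
  assumes "transpose S = S"
  shows "x \<bullet> (S *v y) = (S *v x) \<bullet> y"
  by (metis assms dot_lmul_matrix transpose_matrix_vector)

lemma psd_mat_1: "psd (mat 1 :: real^'n^'n)"
  by (simp add: psd_def)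

text \<open>The form at \<open>x + t *\<^sub>R y\<close> is a nonnegative polynomial in
  \<open>t\<close> of degree at most 2, and its discriminant gives the claim. The form may be
  degenerate, so a vanishing leading coefficient is a separate case.\<close>

lemma psd_Cauchy_Schwarz:
  assumes "psd S"
  shows "(x \<bullet> (S *v y))\<^sup>2 \<le> (x \<bullet> (S *v x)) * (y \<bullet> (S *v y))"
proof -
  define a b c where "a = x \<bullet> (S *v x)" "b = x \<bullet> (S *v y)" "c = y \<bullet> (S *v y)"
  have sym: "transpose S = S" and pos: "\<And>x. 0 \<le> x \<bullet> (S *v x)"
    using assms by (auto simp: psd_def)
  have yx: "y \<bullet> (S *v x) = b"
    unfolding a_b_c_def symmetric_inner_matrix_vector[OF sym, of x y] by (rule inner_commute)
  have q: "0 \<le> a + 2 * t * b + t\<^sup>2 * c" for t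
  proof -
    have "(x + t *\<^sub>R y) \<bullet> (S *v (x + t *\<^sub>R y))
        = x \<bullet> (S *v x) + t * (x \<bullet> (S *v y)) + t * (y \<bullet> (S *v x)) + t * (t * (y \<bullet> (S *v y)))"
      by (simp add: matrix_vector_right_distrib matrix_vector_mult_scaleR inner_add_left inner_add_right
          distrib_left)
    also have "\<dots> = a + 2 * t * b + t\<^sup>2 * c"
      unfolding yx by (simp add: a_b_c_def power2_eq_square)
    finally show ?thesis using pos[of "x + t *\<^sub>R y"] by simp
  qed
  have "b\<^sup>2 \<le> a * c"
  proof (cases "c = 0")
    case True
    have "b = 0"
    proof (rule ccontr)
      assume "b \<noteq> 0"
      \<comment> \<open>This \<open>t\<close> gives the affine polynomial
        \<open>a + 2 * t * b\<close> the value -1.\<close>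
      then show False using q[of "- (a + 1) / (2 * b)"] True by (simp add: field_simps)
    qed
    then show ?thesis using True by simp
  next
    case False
    then have c: "c > 0" using pos[of y] by (simp add: a_b_c_def)
    \<comment> \<open>The value at the minimiser \<open>- b / c\<close>, multiplied by
      \<open>c\<close>.\<close>
    have "0 \<le> (a + 2 * (- b / c) * b + (- b / c)\<^sup>2 * c) * c" using q[of "- b / c"] c by simp
    also have "\<dots> = a * c - b\<^sup>2" using c by (simp add: power2_eq_square field_simps)
    finally show ?thesis by simp
  qed
  then show ?thesis by (simp add: a_b_c_def)
qed

text \<open>Cauchy-Schwarz for the form of \<open>S\<close> with \<open>y = S *v x\<close>, divided
  by \<open>(norm (S *v x))\<^sup>2\<close>. This is the operator inequality S^2 <= |S| S.\<close>

lemma psd_norm_mult_power2_le: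
  assumes "psd S"
  shows "(norm (S *v x))\<^sup>2 \<le> norm S * (x \<bullet> (S *v x))"
proof (cases "S *v x = 0")
  case False
  have sym: "transpose S = S" and pos: "0 \<le> x \<bullet> (S *v x)"
    using assms by (auto simp: psd_def)
  let ?y = "S *v x"
  have "x \<bullet> (S *v ?y) = (norm ?y)\<^sup>2"
    unfolding symmetric_inner_matrix_vector[OF sym, of x ?y] by (simp add: power2_norm_eq_inner)
  then have "(norm ?y)\<^sup>2 * (norm ?y)\<^sup>2 = (x \<bullet> (S *v ?y))\<^sup>2"
    by (simp add: power2_eq_square)
  also have "\<dots> \<le> (x \<bullet> ?y) * (?y \<bullet> (S *v ?y))" by (rule psd_Cauchy_Schwarz[OF assms])
  also have "\<dots> \<le> (x \<bullet> ?y) * (norm ?y * (norm S * norm ?y))"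
    by (intro mult_left_mono pos order_trans[OF norm_cauchy_schwarz] norm_matrix_vector_mult_le) auto
  also have "\<dots> = norm S * (x \<bullet> ?y) * (norm ?y)\<^sup>2" by (simp add: power2_eq_square)
  finally show ?thesis by (rule mult_right_le_imp_le) (use False in simp)
qed (simp add: assms)

lemma inner_axis_matrix_vector_axis:
  fixes A :: "real^'m^'n"
  shows "axis i 1 \<bullet> (A *v axis j 1) = A $ i $ j"
  by (simp add: matrix_vector_mult_basis column_def inner_axis')

lemma psd_diagonal_nonneg: "psd A \<Longrightarrow> 0 \<le> A $ i $ i"
  unfolding psd_def by (metis inner_axis_matrix_vector_axis)

lemma psd_trace_nonneg: "psd A \<Longrightarrow> 0 \<le> trace A"
  by (simp add: trace_def sum_nonneg psd_diagonal_nonneg)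

text \<open>Cauchy-Schwarz on unit vectors bounds the square of each entry by the product of two
  diagonal entries, and these products sum to the square of the trace. Hence the linear functional
  \<open>trace\<close> can stand in for the norm in the a priori bound.\<close>

lemma psd_norm_le_trace:
  assumes "psd A"
  shows "norm A \<le> trace A"
proof -
  have "(norm A)\<^sup>2 \<le> (\<Sum>i\<in>UNIV. \<Sum>j\<in>UNIV. A $ i $ i * A $ j $ j)"
    unfolding norm_matrix_power2
    by (intro sum_mono) (use psd_Cauchy_Schwarz[OF assms, of "axis _ 1" "axis _ 1"] in \<open>simp add: inner_axis_matrix_vector_axis\<close>)
  also have "\<dots> = (trace A)\<^sup>2"
    by (simp add: trace_def power2_eq_square sum_product)
  finally show ?thesis using psd_trace_nonneg[OF assms] by (rule power2_le_imp_le)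
qed

lemma psd_congruence:
  assumes "psd Q" "transpose S = S"
  shows "psd (S ** Q ** S)"
proof -
  have "x \<bullet> ((S ** Q ** S) *v x) = (S *v x) \<bullet> (Q *v (S *v x))" for x
    by (simp add: symmetric_inner_matrix_vector[OF assms(2)] flip: matrix_vector_mul_assoc)
  then show ?thesis
    using assms by (simp add: psd_def matrix_transpose_mul matrix_mul_assoc)
qed

text \<open>The second assumption makes \<open>W\<close> injective, hence invertible as a square
  matrix. Substituting \<open>x = matrix_inv W *v y\<close> in the first one gives an operator
  bound. It is used with \<open>X\<close> the identity or the solution matrix.\<close>

lemma matrix_inv_mult_operator_bound:
  fixes W :: "real^'n^'n"
  assumes "\<And>x. norm (X *v x) \<le> c * norm (W *v x)" "\<And>x. norm x \<le> c' * norm (W *v x)"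
  shows "W ** matrix_inv W = mat 1"
    "norm (X ** matrix_inv W) \<le> real CARD('n) * c"
proof -
  have "invertible W"
    unfolding invertible_left_inverse matrix_left_invertible_ker
  proof (intro allI impI)
    show "x = 0" if "W *v x = 0" for x using assms(2)[of x] that by simp
  qed
  then show inv: "W ** matrix_inv W = mat 1"
    unfolding matrix_inv_def invertible_def by (metis (mono_tags, lifting) someI_ex)
  show "norm (X ** matrix_inv W) \<le> real CARD('n) * c"
  proof (rule norm_matrix_le_operator_bound)
    fix y
    have "norm (X *v (matrix_inv W *v y)) \<le> c * norm (W *v (matrix_inv W *v y))" by (rule assms(1))
    then show "norm ((X ** matrix_inv W) *v y) \<le> c * norm y"
      by (simp add: matrix_vector_mul_assoc inv)
  qed
qed

text \<open>Coercivity and Cauchy-Schwarz give \<open>\<alpha> * norm x \<le> norm (X *v x)\<close>.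
  This will control the inverse of \<open>calN\<close>.\<close>

lemma psd_shift_matrix_inv:
  fixes X :: "real^'n^'n"
  assumes "psd (X - \<alpha> *\<^sub>R mat 1)" "\<alpha> > 0"
  shows "norm (matrix_inv (2 *\<^sub>R X)) \<le> real CARD('n) / (2 * \<alpha>)"
proof -
  have "norm x \<le> 1 / (2 * \<alpha>) * norm ((2 *\<^sub>R X) *v x)" for x
  proof (cases "x = 0")
    case False
    have "0 \<le> x \<bullet> ((X - \<alpha> *\<^sub>R mat 1) *v x)" using assms by (simp add: psd_def)
    then have "\<alpha> * (norm x)\<^sup>2 \<le> x \<bullet> (X *v x)"
      by (simp add: matrix_vector_mult_diff_rdistrib inner_diff_right power2_norm_eq_inner
          flip: scaleR_matrix_vector_assoc)
    also have "\<dots> \<le> norm x * norm (X *v x)" by (rule norm_cauchy_schwarz)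
    finally have "\<alpha> * norm x \<le> norm (X *v x)"
      using False by (simp add: power2_eq_square mult.left_commute)
    then show ?thesis using assms(2) by (simp add: field_simps flip: scaleR_matrix_vector_assoc)
  qed simp
  then show ?thesis
    using matrix_inv_mult_operator_bound(2)[of "mat 1" "1 / (2 * \<alpha>)" "2 *\<^sub>R X" "1 / (2 * \<alpha>)"] by simp
qed

text \<open>Testing \<open>W *v x\<close> against \<open>S *v x\<close> discards the nonnegative
  term with \<open>P\<close> and leaves \<open>x \<bullet> (S *v x)\<close>, which dominates the
  square of \<open>norm (S *v x)\<close> up to the factor \<open>norm S\<close>. The last bound is
  therefore free of \<open>P\<close> and linear in \<open>norm S\<close>, as linear growth of the
  trace requires. The bound of the inverse itself follows by solving \<open>W *v x\<close> for
  \<open>x\<close>.\<close>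

lemma psd_resolvent:
  fixes P S :: "real^'n^'n"
  assumes P: "psd P" and S: "psd S"
  defines "W \<equiv> 2 *\<^sub>R (P ** S) + mat 1"
  shows "W ** matrix_inv W = mat 1"
    "norm (matrix_inv W) \<le> real CARD('n) * (1 + 2 * norm P * norm S)"
    "norm (S ** matrix_inv W) \<le> real CARD('n) * norm S"
proof -
  have W: "W *v x = x + 2 *\<^sub>R (P *v (S *v x))" for x
    unfolding W_def by (simp add: matrix_vector_mult_add_rdistrib add.commute
        flip: scaleR_matrix_vector_assoc matrix_vector_mul_assoc)
  have S_le: "norm (S *v x) \<le> norm S * norm (W *v x)" for x
  proof (cases "S *v x = 0")
    case False
    have "x \<bullet> (S *v x) \<le> (S *v x) \<bullet> (W *v x)"
      using P by (simp add: W inner_add_right psd_def inner_commute)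
    also have "\<dots> \<le> norm (S *v x) * norm (W *v x)" by (rule norm_cauchy_schwarz)
    finally have "norm S * (x \<bullet> (S *v x)) \<le> norm S * (norm (S *v x) * norm (W *v x))"
      by (rule mult_left_mono) simp
    then have "(norm (S *v x))\<^sup>2 \<le> norm S * (norm (S *v x) * norm (W *v x))"
      using psd_norm_mult_power2_le[OF S, of x] by linarith
    then show ?thesis using False by (simp add: power2_eq_square mult.left_commute)
  qed simp
  have id_le: "norm x \<le> (1 + 2 * norm P * norm S) * norm (W *v x)" for x
  proof -
    have "x = W *v x - 2 *\<^sub>R (P *v (S *v x))" by (simp add: W)
    then have "norm x \<le> norm (W *v x) + norm (2 *\<^sub>R (P *v (S *v x)))"
      by (metis norm_triangle_ineq4)
    also have "\<dots> \<le> norm (W *v x) + 2 * (norm P * norm (S *v x))"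
      using norm_matrix_vector_mult_le[of P "S *v x"] by simp
    also have "\<dots> \<le> norm (W *v x) + 2 * (norm P * (norm S * norm (W *v x)))"
      using mult_left_mono[OF S_le[of x], of "norm P"] by simp
    finally show ?thesis by (simp add: algebra_simps)
  qed
  show "W ** matrix_inv W = mat 1"
    "norm (S ** matrix_inv W) \<le> real CARD('n) * norm S"
    using matrix_inv_mult_operator_bound[of S "norm S" W, OF S_le id_le] by auto
  show "norm (matrix_inv W) \<le> real CARD('n) * (1 + 2 * norm P * norm S)"
    using matrix_inv_mult_operator_bound(2)[of "mat 1" _ W, OF _ id_le] id_le by simp
qed

section \<open>Matrix algebra and the difference of two resolvents\<close>

lemma matrix_mult_diff_ldistrib: "A ** (B - C) = A ** B - A ** (C :: real^'k^'m)"
  by (simp add: vec_eq_iff matrix_matrix_mult_def sum_subtractf algebra_simps)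

lemma matrix_mult_diff_rdistrib: "(A - B) ** C = A ** C - B ** (C :: real^'k^'m)"
  by (simp add: vec_eq_iff matrix_matrix_mult_def sum_subtractf algebra_simps)

lemma matrix_mult_add_rdistrib: "(A + B) ** C = A ** C + B ** (C :: real^'k^'m)"
  by (simp add: vec_eq_iff matrix_matrix_mult_def sum.distrib algebra_simps)

lemma matrix_mult_scaleR_left: "(c *\<^sub>R A) ** C = c *\<^sub>R (A ** (C :: real^'k^'m))"
  by (simp add: vec_eq_iff matrix_matrix_mult_def sum_distrib_left mult.assoc)

lemma matrix_mult_scaleR_right: "A ** (c *\<^sub>R C) = c *\<^sub>R (A ** (C :: real^'k^'m))"
  by (simp add: vec_eq_iff matrix_matrix_mult_def sum_distrib_left mult.left_commute)

lemma transpose_add: "transpose (A + B) = transpose A + transpose (B :: real^'k^'m)"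
  by (simp add: vec_eq_iff transpose_def)

text \<open>\<open>W S\<^sub>1\<close> need not be symmetric, but
  \<open>S\<^sub>1 ** matrix_inv (W S\<^sub>1)\<close> is. So the first inverse can be moved to the
  left as a transpose, and the difference is enclosed between two inverses.\<close>

lemma psd_resolvent_diff:
  fixes P S\<^sub>1 S\<^sub>2 :: "real^'n^'n"
  assumes P: "psd P" and S: "psd S\<^sub>1" "psd S\<^sub>2"
  defines "W \<equiv> \<lambda>S. 2 *\<^sub>R (P ** S) + mat 1"
  shows "S\<^sub>1 ** matrix_inv (W S\<^sub>1) - S\<^sub>2 ** matrix_inv (W S\<^sub>2)
    = transpose (matrix_inv (W S\<^sub>1)) ** (S\<^sub>1 - S\<^sub>2) ** matrix_inv (W S\<^sub>2)"
proof -
  have inv: "W S ** matrix_inv (W S) = mat 1" if "psd S" for S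
    unfolding W_def by (rule psd_resolvent(1)[OF P that])
  let ?V1 = "matrix_inv (W S\<^sub>1)" and ?V2 = "matrix_inv (W S\<^sub>2)"
  have sym: "transpose P = P" "transpose S\<^sub>1 = S\<^sub>1" using P S by (auto simp: psd_def)
  have Wt: "transpose (W S\<^sub>1) = 2 *\<^sub>R (S\<^sub>1 ** P) + mat 1"
    by (simp add: W_def transpose_add transpose_scalar matrix_transpose_mul sym)
  have Vt: "transpose ?V1 ** transpose (W S\<^sub>1) = mat 1"
    by (metis inv[OF S(1)] matrix_transpose_mul transpose_mat)
  \<comment> \<open>Both sides equal
    \<open>2 *\<^sub>R (S\<^sub>1 ** P ** S\<^sub>1) + S\<^sub>1\<close>; enclosing them between the
    inverses yields the symmetry \<open>Y1\<close>.\<close>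
  have "transpose (W S\<^sub>1) ** S\<^sub>1 = S\<^sub>1 ** W S\<^sub>1"
    unfolding Wt by (simp add: W_def matrix_mult_add_rdistrib matrix_add_ldistrib matrix_mult_scaleR_left
        matrix_mult_scaleR_right matrix_mul_assoc)
  then have "transpose ?V1 ** (transpose (W S\<^sub>1) ** S\<^sub>1) ** ?V1 = transpose ?V1 ** (S\<^sub>1 ** W S\<^sub>1) ** ?V1"
    by simp
  then have Y1: "S\<^sub>1 ** ?V1 = transpose ?V1 ** S\<^sub>1"
    by (metis Vt inv[OF S(1)] matrix_mul_assoc matrix_mul_lid matrix_mul_rid)
  \<comment> \<open>The mixed products \<open>S\<^sub>1 ** P ** S\<^sub>2\<close> cancel.\<close>
  have "S\<^sub>1 ** W S\<^sub>2 - transpose (W S\<^sub>1) ** S\<^sub>2 = S\<^sub>1 - S\<^sub>2"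
    unfolding Wt by (simp add: W_def matrix_mult_add_rdistrib matrix_add_ldistrib matrix_mult_scaleR_left
        matrix_mult_scaleR_right matrix_mul_assoc)
  then have "transpose ?V1 ** (S\<^sub>1 - S\<^sub>2) ** ?V2
      = transpose ?V1 ** (S\<^sub>1 ** W S\<^sub>2 - transpose (W S\<^sub>1) ** S\<^sub>2) ** ?V2" by simp
  also have "\<dots> = transpose ?V1 ** S\<^sub>1 ** (W S\<^sub>2 ** ?V2) - (transpose ?V1 ** transpose (W S\<^sub>1)) ** S\<^sub>2 ** ?V2"
    by (simp add: matrix_mult_diff_ldistrib matrix_mult_diff_rdistrib matrix_mul_assoc)
  also have "\<dots> = S\<^sub>1 ** ?V1 - S\<^sub>2 ** ?V2" by (simp add: inv[OF S(2)] Vt Y1)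
  finally show ?thesis by simp
qed

text \<open>Both inverses around the difference are bounded uniformly for matrices of norm at most
  \<open>\<rho>\<close>, whence the square.\<close>

lemma norm_psd_resolvent_diff_le:
  fixes P S\<^sub>1 S\<^sub>2 :: "real^'n^'n"
  assumes P: "psd P" and S: "psd S\<^sub>1" "psd S\<^sub>2" and le: "norm P \<le> k" "norm S\<^sub>1 \<le> \<rho>" "norm S\<^sub>2 \<le> \<rho>"
  shows "norm (S\<^sub>1 ** matrix_inv (2 *\<^sub>R (P ** S\<^sub>1) + mat 1) - S\<^sub>2 ** matrix_inv (2 *\<^sub>R (P ** S\<^sub>2) + mat 1))
    \<le> (real CARD('n) * (1 + 2 * k * \<rho>))\<^sup>2 * norm (S\<^sub>1 - S\<^sub>2)"
proof -
  let ?V = "\<lambda>S. matrix_inv (2 *\<^sub>R (P ** S) + mat 1)" and ?c = "real CARD('n) * (1 + 2 * k * \<rho>)"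
  have nn: "0 \<le> k" "0 \<le> \<rho>" using le norm_ge_zero order_trans by blast+
  have V: "norm (?V S) \<le> ?c" if "psd S" "norm S \<le> \<rho>" for S
  proof -
    have "norm P * norm S \<le> k * \<rho>" using le(1) that(2) nn by (intro mult_mono) auto
    then have "real CARD('n) * (1 + 2 * norm P * norm S) \<le> ?c" by (intro mult_left_mono) auto
    then show ?thesis using psd_resolvent(2)[OF P that(1)] by linarith
  qed
  have "norm (transpose (?V S\<^sub>1) ** (S\<^sub>1 - S\<^sub>2) ** ?V S\<^sub>2) \<le> norm (?V S\<^sub>1) * norm (S\<^sub>1 - S\<^sub>2) * norm (?V S\<^sub>2)"
    using norm_matrix_mult_le[of "transpose (?V S\<^sub>1)" "S\<^sub>1 - S\<^sub>2"]
    by (intro order_trans[OF norm_matrix_mult_le] mult_right_mono) (simp_all add: norm_transpose)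
  also have "\<dots> \<le> ?c * norm (S\<^sub>1 - S\<^sub>2) * ?c"
    using V S le nn by (intro mult_mono) auto
  finally show ?thesis
    by (simp add: psd_resolvent_diff[OF P S] power2_eq_square mult_ac)
qed

section \<open>The delayed Riccati equation\<close>

text \<open>The almost-everywhere conditions at a single time, packaged because the equation at
  \<open>t\<close> calls for them at \<open>t\<close> and at \<open>t - \<delta>\<close>.\<close>

definition psd_data :: "real \<Rightarrow> real \<Rightarrow> ('n::finite, 'd::finite) riccati_coeffs \<Rightarrow> real \<Rightarrow> bool" where
  "psd_data \<alpha> \<delta> D t \<longleftrightarrow> psd (cQ D t + cQb D (t + \<delta>)) \<and> psd (cR D t + cRb D (t + \<delta>)) \<and>
     psd (cN D t + cNb D (t + \<delta>) - \<alpha> *\<^sub>R mat 1)"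

text \<open>The exceptional set for \<open>t - \<delta>\<close> is a translate of the one for
  \<open>t\<close>, hence null as well, and the conditions reach back to
  \<open>s - \<delta>\<close>.\<close>

lemma admissible_AE_psd_data:
  assumes adm: "admissible K \<alpha> \<delta> s T D" and "0 < \<delta>"
  shows "AE t\<in>{s..T} in lebesgue. psd_data \<alpha> \<delta> D t \<and> psd_data \<alpha> \<delta> D (t - \<delta>)"
proof -
  have "AE t\<in>{s-\<delta>..T} in lebesgue. psd_data \<alpha> \<delta> D t"
    using adm unfolding admissible_def psd_data_def by blast
  then obtain E where E: "negligible E" "{t. \<not> (t \<in> {s-\<delta>..T} \<longrightarrow> psd_data \<alpha> \<delta> D t)} \<subseteq> E"
    unfolding eventually_ae_filter_negligible by blast
  have "negligible (E \<union> (+) \<delta> ` E)" using E(1) by (simp add: negligible_Un negligible_translation)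
  moreover have "{t. \<not> (t \<in> {s..T} \<longrightarrow> psd_data \<alpha> \<delta> D t \<and> psd_data \<alpha> \<delta> D (t - \<delta>))} \<subseteq> E \<union> (+) \<delta> ` E"
  proof
    fix t assume "t \<in> {t. \<not> (t \<in> {s..T} \<longrightarrow> psd_data \<alpha> \<delta> D t \<and> psd_data \<alpha> \<delta> D (t - \<delta>))}"
    then have t: "t \<in> {s..T}" "\<not> psd_data \<alpha> \<delta> D t \<or> \<not> psd_data \<alpha> \<delta> D (t - \<delta>)" by auto
    then have "t \<in> {s-\<delta>..T}" "t - \<delta> \<in> {s-\<delta>..T}" using \<open>0 < \<delta>\<close> by auto
    then have "t \<in> E \<or> t - \<delta> \<in> E" using t(2) E(2) by blast
    moreover have "t \<in> (+) \<delta> ` E" if "t - \<delta> \<in> E" using that by (intro image_eqI[of _ _ "t - \<delta>"]) auto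
    ultimately show "t \<in> E \<union> (+) \<delta> ` E" by blast
  qed
  ultimately show ?thesis unfolding eventually_ae_filter_negligible by blast
qed

lemma admissible_norm_le:
  assumes adm: "admissible K \<alpha> \<delta> s T D"
  shows "t \<in> {s..T} \<Longrightarrow> norm (cA D t) \<le> K" "t \<in> {s..T} \<Longrightarrow> norm (cB D t) \<le> K"
    "t \<in> {s..T} \<Longrightarrow> norm (cBb D t) \<le> K" "t \<in> {s..T} \<Longrightarrow> norm (cC D t) \<le> K"
    "t \<in> {s..T} \<Longrightarrow> norm (cCb D t) \<le> K"
    "t \<in> {s-\<delta>..T} \<Longrightarrow> norm (cQ D t + cQb D (t + \<delta>)) \<le> 2 * K"
    "t \<in> {s-\<delta>..T} \<Longrightarrow> norm (cR D t + cRb D (t + \<delta>)) \<le> 2 * K"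
proof -
  have *: "\<forall>t\<in>{s..T}. norm (cA D t) \<le> K \<and> norm (cB D t) \<le> K \<and> norm (cBb D t) \<le> K \<and>
      norm (cC D t) \<le> K \<and> norm (cCb D t) \<le> K"
    "\<forall>t\<in>{s-\<delta>..T}. norm (cQ D t) \<le> K \<and> norm (cR D t) \<le> K"
    "\<forall>t\<in>{s..T+\<delta>}. norm (cQb D t) \<le> K \<and> norm (cRb D t) \<le> K"
    using adm unfolding admissible_def bdd_meas_on_def by auto
  show "t \<in> {s..T} \<Longrightarrow> norm (cA D t) \<le> K" "t \<in> {s..T} \<Longrightarrow> norm (cB D t) \<le> K"
    "t \<in> {s..T} \<Longrightarrow> norm (cBb D t) \<le> K" "t \<in> {s..T} \<Longrightarrow> norm (cC D t) \<le> K"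
    "t \<in> {s..T} \<Longrightarrow> norm (cCb D t) \<le> K"
    using *(1) by auto
  assume t: "t \<in> {s-\<delta>..T}"
  then have "t + \<delta> \<in> {s..T+\<delta>}" by auto
  then show "norm (cQ D t + cQb D (t + \<delta>)) \<le> 2 * K" "norm (cR D t + cRb D (t + \<delta>)) \<le> 2 * K"
    using *(2,3) t norm_triangle_ineq[of "cQ D t" "cQb D (t + \<delta>)"]
      norm_triangle_ineq[of "cR D t" "cRb D (t + \<delta>)"] by fastforce+
qed

text \<open>Brings \<open>calM\<close> into the form of the resolvent lemmas, with \<open>P\<close>
  the sum of the two weights.\<close>

lemma calM_altdef: "calM \<delta> D S t = 2 *\<^sub>R ((cR D t + cRb D (t + \<delta>)) ** S t) + mat 1"
  by (simp add: calM_def matrix_mult_add_rdistrib scaleR_add_right)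

lemma calN_altdef: "calN \<delta> D t = 2 *\<^sub>R (cN D t + cNb D (t + \<delta>))"
  by (simp add: calN_def scaleR_add_right)

lemma norm_congruence_le:
  fixes B :: "real^'m^'n" and Y :: "real^'m^'m"
  assumes "norm B \<le> k"
  shows "norm (B ** Y ** transpose B) \<le> k\<^sup>2 * norm Y"
proof -
  have "norm (B ** Y ** transpose B) \<le> norm (B ** Y) * norm B"
    using norm_matrix_mult_le[of "B ** Y" "transpose B"] by (simp add: norm_transpose)
  also have "\<dots> \<le> (norm B * norm Y) * norm B"
    by (intro mult_right_mono norm_matrix_mult_le) simp
  also have "\<dots> = (norm B)\<^sup>2 * norm Y" by (simp add: power2_eq_square)
  also have "\<dots> \<le> k\<^sup>2 * norm Y" using assms by (intro mult_right_mono power_mono) auto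
  finally show ?thesis .
qed

section \<open>Estimates of the right-hand side\<close>

text \<open>The quadratic term has the favourable sign in reversed time, so the growth is at most linear.\<close>

lemma trace_riccati_rhs_ge:
  fixes D :: "('n::finite, 'd::finite) riccati_coeffs"
  assumes adm: "admissible K \<alpha> \<delta> s T D" and pos: "0 \<le> K" "0 < \<alpha>" "0 < \<delta>" and t: "t \<in> {s..T}"
    and data: "psd_data \<alpha> \<delta> D t" "psd_data \<alpha> \<delta> D (t - \<delta>)"
    and S: "psd (S t)" "psd (S (t - \<delta>))"
  defines "n \<equiv> real CARD('n)" and "d \<equiv> real CARD('d)"
  shows "- trace (riccati_rhs \<delta> D S t)
    \<le> n * (2 * K + n * K\<^sup>2) * trace (S t) + n\<^sup>2 * K\<^sup>2 * trace (S (t - \<delta>)) + n * K\<^sup>2 * d / \<alpha>"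
proof -
  note le = admissible_norm_le[OF adm]
  define Y where "Y t = S t ** matrix_inv (calM \<delta> D S t)" for t
  define V where "V t = matrix_inv (calN \<delta> D t)" for t
  have n: "n \<ge> 0" by (simp add: n_def)
  have Y: "norm (Y r) \<le> n * norm (S r)" if "psd_data \<alpha> \<delta> D r" "psd (S r)" for r
    using psd_resolvent(3)[of "cR D r + cRb D (r + \<delta>)" "S r"] that
    by (simp add: Y_def calM_altdef psd_data_def n_def)
  have V: "norm (V r) \<le> d / (2 * \<alpha>)" if "psd_data \<alpha> \<delta> D r" for r
    using psd_shift_matrix_inv[of "cN D r + cNb D (r + \<delta>)" \<alpha>] that pos(2)
    by (simp add: V_def calN_altdef psd_data_def d_def)
  have tr: "\<bar>trace X\<bar> \<le> n * c" if "norm X \<le> c" for X :: "real^'n^'n" and c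
    unfolding n_def by (rule order_trans[OF abs_trace_le mult_left_mono[OF that]]) simp
  have rhs: "- trace (riccati_rhs \<delta> D S t) =
      trace (S t ** transpose (cA D t)) + trace (cA D t ** S t)
      - 2 * trace (S t ** (cQ D t + cQb D (t + \<delta>)) ** S t)
      + trace (cB D t ** Y t ** transpose (cB D t)) + trace (cC D t ** V t ** transpose (cC D t))
      + trace (cBb D t ** Y (t - \<delta>) ** transpose (cBb D t))
      + trace (cCb D t ** V (t - \<delta>) ** transpose (cCb D t))"
    \<comment> \<open>The factor -1 supplies the trace of the negated first summand.\<close>
    using trace_scaleR[of "-1" "S t ** transpose (cA D t)"]
    by (simp add: riccati_rhs_def Y_def V_def trace_sub trace_add trace_scaleR matrix_mul_assoc)
  have A: "norm (cA D t) \<le> K" using le t by blast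
  have "norm (S t ** transpose (cA D t)) \<le> norm (S t) * K" "norm (cA D t ** S t) \<le> norm (S t) * K"
    using norm_matrix_mult_le[of "S t" "transpose (cA D t)"] norm_matrix_mult_le[of "cA D t" "S t"]
      mult_left_mono[OF A, of "norm (S t)"] by (auto simp: norm_transpose mult.commute)
  note AS = this[THEN tr]
  have Q: "trace (S t ** (cQ D t + cQb D (t + \<delta>)) ** S t) \<ge> 0"
    using data S by (intro psd_trace_nonneg psd_congruence) (auto simp: psd_data_def psd_def)
  have BY: "\<bar>trace (B ** Y r ** transpose B)\<bar> \<le> n * (K\<^sup>2 * (n * norm (S r)))"
    if "norm B \<le> K" "psd_data \<alpha> \<delta> D r" "psd (S r)" for B :: "real^'n^'n" and r
    using norm_congruence_le[OF that(1), of "Y r"] mult_left_mono[OF Y[OF that(2,3)], of "K\<^sup>2"]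
    by (intro tr) simp
  have CV: "\<bar>trace (C ** V r ** transpose C)\<bar> \<le> n * (K\<^sup>2 * (d / (2 * \<alpha>)))"
    if "norm C \<le> K" "psd_data \<alpha> \<delta> D r" for C :: "real^'d^'n" and r
    using norm_congruence_le[OF that(1), of "V r"] mult_left_mono[OF V[OF that(2)], of "K\<^sup>2"]
    by (intro tr) simp
  have "- trace (riccati_rhs \<delta> D S t) \<le> 2 * (n * (norm (S t) * K)) + n * (K\<^sup>2 * (n * norm (S t)))
      + n * (K\<^sup>2 * (n * norm (S (t - \<delta>)))) + 2 * (n * (K\<^sup>2 * (d / (2 * \<alpha>))))"
    using AS Q BY[OF le(2)[OF t] data(1) S(1)] BY[OF le(3)[OF t] data(2) S(2)]
      CV[OF le(4)[OF t] data(1)] CV[OF le(5)[OF t] data(2)] unfolding rhs by linarith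
  also have "\<dots> = n * (2 * K + n * K\<^sup>2) * norm (S t) + n\<^sup>2 * K\<^sup>2 * norm (S (t - \<delta>)) + n * K\<^sup>2 * d / \<alpha>"
    using pos(2) by (simp add: field_simps power2_eq_square)
  \<comment> \<open>Replacing norms by traces closes the inequality in the trace alone.\<close>
  also have "\<dots> \<le> n * (2 * K + n * K\<^sup>2) * trace (S t) + n\<^sup>2 * K\<^sup>2 * trace (S (t - \<delta>)) + n * K\<^sup>2 * d / \<alpha>"
    using psd_norm_le_trace[OF S(1)] psd_norm_le_trace[OF S(2)] n pos
    by (intro add_mono mult_left_mono) auto
  finally show ?thesis .
qed

text \<open>The terms with \<open>calN\<close> do not involve the solution and cancel, the quadratic
  term splits into two products linear in the difference, and the terms with \<open>calM\<close>
  fall under the resolvent estimate with \<open>k = 2 * K\<close>, the source of the 4 in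
  \<open>m\<close>. The 8 collects the outer factor 2, the two products and the bound
  \<open>2 * K\<close> of \<open>Q\<close>.\<close>

lemma norm_riccati_rhs_diff_le:
  fixes D :: "('n::finite, 'd::finite) riccati_coeffs"
  assumes adm: "admissible K \<alpha> \<delta> s T D" and pos: "0 \<le> K" "0 < \<delta>" and t: "t \<in> {s..T}"
    and data: "psd_data \<alpha> \<delta> D t" "psd_data \<alpha> \<delta> D (t - \<delta>)"
    and psd: "psd (S\<^sub>1 t)" "psd (S\<^sub>1 (t - \<delta>))" "psd (S\<^sub>2 t)" "psd (S\<^sub>2 (t - \<delta>))"
    and bound: "norm (S\<^sub>1 t) \<le> \<rho>" "norm (S\<^sub>1 (t - \<delta>)) \<le> \<rho>" "norm (S\<^sub>2 t) \<le> \<rho>" "norm (S\<^sub>2 (t - \<delta>)) \<le> \<rho>"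
  defines "m \<equiv> (real CARD('n) * (1 + 4 * K * \<rho>))\<^sup>2"
  shows "norm (riccati_rhs \<delta> D S\<^sub>1 t - riccati_rhs \<delta> D S\<^sub>2 t)
    \<le> (2 * K + 8 * K * \<rho> + K\<^sup>2 * m) * norm (S\<^sub>1 t - S\<^sub>2 t) + K\<^sup>2 * m * norm (S\<^sub>1 (t - \<delta>) - S\<^sub>2 (t - \<delta>))"
proof -
  note le = admissible_norm_le[OF adm]
  define Y where "Y S t = S t ** matrix_inv (calM \<delta> D S t)" for S t
  define E where "E t = S\<^sub>1 t - S\<^sub>2 t" for t
  define Q where "Q = cQ D t + cQb D (t + \<delta>)"
  have Y: "norm (Y S\<^sub>1 r - Y S\<^sub>2 r) \<le> m * norm (E r)"
    if "r \<in> {s-\<delta>..T}" "psd_data \<alpha> \<delta> D r" "psd (S\<^sub>1 r)" "psd (S\<^sub>2 r)" "norm (S\<^sub>1 r) \<le> \<rho>" "norm (S\<^sub>2 r) \<le> \<rho>" for r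
    using norm_psd_resolvent_diff_le[of "cR D r + cRb D (r + \<delta>)" "S\<^sub>1 r" "S\<^sub>2 r" "2 * K" \<rho>] le(7)[OF that(1)] that
    by (simp add: Y_def calM_altdef psd_data_def m_def E_def)
  have BY: "norm (B ** (Y S\<^sub>1 r - Y S\<^sub>2 r) ** transpose B) \<le> K\<^sup>2 * m * norm (E r)"
    if "norm B \<le> K" "norm (Y S\<^sub>1 r - Y S\<^sub>2 r) \<le> m * norm (E r)" for B :: "real^'n^'n" and r
    using norm_congruence_le[OF that(1), of "Y S\<^sub>1 r - Y S\<^sub>2 r"] mult_left_mono[OF that(2), of "K\<^sup>2"] by simp
  have tt: "t \<in> {s-\<delta>..T}" "t - \<delta> \<in> {s-\<delta>..T}" using t pos by auto
  have QS: "S\<^sub>1 t ** Q ** S\<^sub>1 t - S\<^sub>2 t ** Q ** S\<^sub>2 t = E t ** Q ** S\<^sub>1 t + S\<^sub>2 t ** Q ** E t"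
    by (simp add: E_def matrix_mult_diff_ldistrib matrix_mult_diff_rdistrib)
  have rhs: "riccati_rhs \<delta> D S\<^sub>1 t - riccati_rhs \<delta> D S\<^sub>2 t =
      2 *\<^sub>R (E t ** Q ** S\<^sub>1 t + S\<^sub>2 t ** Q ** E t)
      - E t ** transpose (cA D t) - cA D t ** E t
      - cB D t ** (Y S\<^sub>1 t - Y S\<^sub>2 t) ** transpose (cB D t)
      - cBb D t ** (Y S\<^sub>1 (t - \<delta>) - Y S\<^sub>2 (t - \<delta>)) ** transpose (cBb D t)"
    unfolding QS[symmetric]
    by (simp add: riccati_rhs_def Y_def E_def Q_def matrix_mult_diff_ldistrib matrix_mult_diff_rdistrib
        matrix_mul_assoc scaleR_diff_right)
  have Q: "norm Q \<le> 2 * K" unfolding Q_def by (rule le(6)[OF tt(1)])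
  have "norm (E t ** Q ** S\<^sub>1 t) \<le> norm (E t) * (2 * K) * \<rho>"
    using Q bound pos
    by (intro order_trans[OF norm_matrix_mult_le] mult_mono mult_left_mono) auto
  moreover have "norm (S\<^sub>2 t ** Q ** E t) \<le> \<rho> * (2 * K) * norm (E t)"
    using Q bound pos order_trans[OF norm_ge_zero bound(1)]
    by (intro order_trans[OF norm_matrix_mult_le] mult_right_mono mult_mono) auto
  ultimately have "norm (E t ** Q ** S\<^sub>1 t + S\<^sub>2 t ** Q ** E t) \<le> 4 * K * \<rho> * norm (E t)"
    using norm_triangle_ineq[of "E t ** Q ** S\<^sub>1 t" "S\<^sub>2 t ** Q ** E t"] by (simp add: algebra_simps)
  then have QE: "norm (2 *\<^sub>R (E t ** Q ** S\<^sub>1 t + S\<^sub>2 t ** Q ** E t)) \<le> 8 * K * \<rho> * norm (E t)"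
    by simp
  have A: "norm (cA D t) \<le> K" using le t by blast
  have AE: "norm (E t ** transpose (cA D t)) \<le> K * norm (E t)" "norm (cA D t ** E t) \<le> K * norm (E t)"
    using norm_matrix_mult_le[of "E t" "transpose (cA D t)"] norm_matrix_mult_le[of "cA D t" "E t"]
      mult_left_mono[OF A, of "norm (E t)"] by (auto simp: norm_transpose mult.commute)
  have tri: "norm (x - y - z - u - v) \<le> norm x + norm y + norm z + norm u + norm v" for x y z u v :: "real^'n^'n"
    by (intro order_trans[OF norm_triangle_ineq4] add_mono order_refl)
  have "norm (riccati_rhs \<delta> D S\<^sub>1 t - riccati_rhs \<delta> D S\<^sub>2 t)
      \<le> 8 * K * \<rho> * norm (E t) + K * norm (E t) + K * norm (E t) + K\<^sup>2 * m * norm (E t) + K\<^sup>2 * m * norm (E (t - \<delta>))"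
    unfolding rhs
    by (intro order_trans[OF tri] add_mono QE AE BY Y le t tt data psd bound)
  then show ?thesis by (simp add: E_def algebra_simps)
qed

section \<open>A priori bound and uniqueness of solutions\<close>

lemma riccati_solution_psd:
  assumes "riccati_solution \<delta> s T D M S" "S \<in> C_psd s T" "t \<in> {s-\<delta>..T}"
  shows "psd (S t)"
proof (cases "t < s")
  case True
  then have "S t = mat 1" using assms by (auto simp: riccati_solution_def)
  then show ?thesis by (simp add: psd_mat_1)
qed (use assms in \<open>auto simp: C_psd_def\<close>)

text \<open>Gronwall for the trace, which is its own majorant \<open>h\<close> at every
  \<open>t0\<close>. The history bound \<open>n\<close> is the trace of the identity, and the
  terminal bound \<open>n * K\<close> comes from the norm of \<open>M\<close>.\<close>

lemma riccati_solution_trace_le: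
  fixes D :: "('n::finite, 'd::finite) riccati_coeffs"
  assumes adm: "admissible K \<alpha> \<delta> s T D" and pos: "0 \<le> K" "0 < \<alpha>" "0 < \<delta>" and "s \<le> T"
    and M: "norm M \<le> K"
    and sol: "riccati_solution \<delta> s T D M S" "S \<in> C_psd s T"
  defines "n \<equiv> real CARD('n)" and "d \<equiv> real CARD('d)"
  defines "a \<equiv> n * (2 * K + n * K\<^sup>2)" and "b \<equiv> n\<^sup>2 * K\<^sup>2" and "c \<equiv> n * K\<^sup>2 * d / \<alpha>"
  assumes small: "exp (2 * (a + 2 * b + 1) * \<delta>) \<le> 2" and t: "t \<in> {s..T}"
  shows "trace (S t) \<le> 2 * (n * K + (b * n + c) * (T - s)) * exp (2 * (a + 2 * b + 1) * (T - s))"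
proof (rule delayed_gronwall_backward[OF \<open>s \<le> T\<close>, where p = "\<lambda>t. trace (S t)" and \<delta> = \<delta>])
  have n: "n \<ge> 0" "d \<ge> 0" by (simp_all add: n_def d_def)
  show "0 \<le> a" "0 \<le> b" "0 \<le> c" "0 \<le> n"
    using n pos by (simp_all add: a_def b_def c_def)
  show "continuous_on {s..T} (\<lambda>t. trace (S t))"
    using sol(2) by (intro bounded_linear.continuous_on[OF bounded_linear_trace]) (simp add: C_psd_def)
  show "0 \<le> trace (S t)" if "t \<in> {s..T}" for t
    using that riccati_solution_psd[OF sol] pos by (intro psd_trace_nonneg) auto
  show "trace (S t) \<le> n" if "t \<in> {s-\<delta>..<s}" for t
    using that sol(1) by (simp add: riccati_solution_def n_def trace_I)
  have "trace (S T) \<le> n * K"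
    using order_trans[OF abs_trace_le mult_left_mono[OF M]] sol(1)
    by (simp add: riccati_solution_def n_def abs_le_iff)
  moreover have "abs_continuous_on_interval s T (\<lambda>t. trace (S t))"
    using sol(1) by (intro abs_continuous_on_interval_bounded_linear[OF bounded_linear_trace])
      (simp add: riccati_solution_def)
  moreover have "AE t\<in>{s..T} in lebesgue. \<exists>h'. ((\<lambda>t. trace (S t)) has_vector_derivative h') (at t within {s..T}) \<and>
           - h' \<le> a * trace (S t) + b * trace (S (t - \<delta>)) + c"
  proof -
    have "AE t\<in>{s..T} in lebesgue. (S has_vector_derivative riccati_rhs \<delta> D S t) (at t within {s..T})"
      using sol(1) by (simp add: riccati_solution_def)
    with admissible_AE_psd_data[OF adm pos(3)] show ?thesis
    proof eventually_elim
      case (elim t)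
      show ?case
      proof
        assume t: "t \<in> {s..T}"
        then have "((\<lambda>t. trace (S t)) has_vector_derivative trace (riccati_rhs \<delta> D S t)) (at t within {s..T})"
          using elim by (intro bounded_linear.has_vector_derivative[OF bounded_linear_trace]) simp
        moreover have "- trace (riccati_rhs \<delta> D S t) \<le> a * trace (S t) + b * trace (S (t - \<delta>)) + c"
          unfolding a_def b_def c_def n_def d_def
          using t elim pos by (intro trace_riccati_rhs_ge[OF adm pos t] riccati_solution_psd[OF sol]) auto
        ultimately show "\<exists>h'. ((\<lambda>t. trace (S t)) has_vector_derivative h') (at t within {s..T}) \<and>
           - h' \<le> a * trace (S t) + b * trace (S (t - \<delta>)) + c" by blast
      qed
    qed
  qed
  ultimately show "\<exists>h. abs_continuous_on_interval s T h \<and> trace (S t0) \<le> h t0 \<and> h T \<le> n * K \<and>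
        (AE t\<in>{s..T} in lebesgue. \<exists>h'. (h has_vector_derivative h') (at t within {s..T}) \<and>
           - h' \<le> a * trace (S t) + b * trace (S (t - \<delta>)) + c)" for t0
    by (intro exI[of _ "\<lambda>t. trace (S t)"]) simp
qed (use small t pos in auto)

text \<open>The two solutions share history and terminal value, so Gronwall applies to the norm of
  their difference with \<open>H = P = c = 0\<close> and returns the bound 0.\<close>

lemma riccati_solution_unique:
  fixes D :: "('n::finite, 'd::finite) riccati_coeffs"
  assumes adm: "admissible K \<alpha> \<delta> s T D" and pos: "0 \<le> K" "0 < \<delta>" and "s \<le> T"
    and sol1: "riccati_solution \<delta> s T D M S\<^sub>1" "S\<^sub>1 \<in> C_psd s T"
    and sol2: "riccati_solution \<delta> s T D M S\<^sub>2" "S\<^sub>2 \<in> C_psd s T"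
    and bound: "\<And>t. t \<in> {s-\<delta>..T} \<Longrightarrow> norm (S\<^sub>1 t) \<le> \<rho>" "\<And>t. t \<in> {s-\<delta>..T} \<Longrightarrow> norm (S\<^sub>2 t) \<le> \<rho>"
  defines "m \<equiv> (real CARD('n) * (1 + 4 * K * \<rho>))\<^sup>2"
  defines "a \<equiv> 2 * K + 8 * K * \<rho> + K\<^sup>2 * m" and "b \<equiv> K\<^sup>2 * m"
  assumes small: "exp (2 * (a + 2 * b + 1) * \<delta>) \<le> 2" and t: "t \<in> {s-\<delta>..T}"
  shows "S\<^sub>1 t = S\<^sub>2 t"
proof (cases "t < s")
  case True
  then show ?thesis using sol1 sol2 t by (auto simp: riccati_solution_def)
next
  case False
  then have t: "t \<in> {s..T}" using t by simp
  define E where "E t = S\<^sub>1 t - S\<^sub>2 t" for t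
  have "norm (E t) \<le> 2 * (0 + (b * 0 + 0) * (T - s)) * exp (2 * (a + 2 * b + 1) * (T - s))"
  proof (rule delayed_gronwall_backward[OF \<open>s \<le> T\<close>, where p = "\<lambda>t. norm (E t)" and \<delta> = \<delta>])
    have "T \<in> {s-\<delta>..T}" using \<open>s \<le> T\<close> pos by simp
    then have \<rho>: "\<rho> \<ge> 0" using bound(1) norm_ge_zero order_trans by blast
    show "0 \<le> a" "0 \<le> b" using \<rho> pos by (simp_all add: a_def b_def m_def)
    show "continuous_on {s..T} (\<lambda>t. norm (E t))"
      unfolding E_def using sol1(2) sol2(2) by (intro continuous_intros) (auto simp: C_psd_def)
    show "norm (E t) \<le> 0" if "t \<in> {s-\<delta>..<s}" for t
      using that sol1(1) sol2(1) by (simp add: riccati_solution_def E_def)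
    fix t0
    \<comment> \<open>A supporting functional of the norm at \<open>E t0\<close>:
      \<open>w \<bullet> E t\<close> is differentiable wherever \<open>E\<close> is, agrees with the
      norm at \<open>t0\<close>, and has its derivative controlled by \<open>norm w \<le> 1\<close>.
      If \<open>E t0 = 0\<close>, then \<open>w = 0\<close> and all of this remains true.\<close>
    define w where "w = sgn (E t0)"
    have w: "norm w \<le> 1" by (simp add: w_def norm_sgn)
    have wE: "w \<bullet> E t0 = norm (E t0)"
      by (cases "E t0 = 0") (simp_all add: w_def sgn_div_norm power2_eq_square flip: power2_norm_eq_inner)
    have L: "bounded_linear ((\<bullet>) w)" by (rule bounded_linear_inner_right)
    have "abs_continuous_on_interval s T (\<lambda>t. w \<bullet> E t)"
      unfolding E_def using sol1(1) sol2(1)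
      by (intro abs_continuous_on_interval_bounded_linear[OF L] abs_continuous_on_interval_diff)
        (simp_all add: riccati_solution_def)
    moreover have "E T = 0" using sol1(1) sol2(1) by (simp add: riccati_solution_def E_def)
    moreover have "AE t\<in>{s..T} in lebesgue. \<exists>h'. ((\<lambda>t. w \<bullet> E t) has_vector_derivative h') (at t within {s..T}) \<and>
           - h' \<le> a * norm (E t) + b * norm (E (t - \<delta>)) + 0"
    proof -
      have "AE t\<in>{s..T} in lebesgue. (S\<^sub>1 has_vector_derivative riccati_rhs \<delta> D S\<^sub>1 t) (at t within {s..T})"
        "AE t\<in>{s..T} in lebesgue. (S\<^sub>2 has_vector_derivative riccati_rhs \<delta> D S\<^sub>2 t) (at t within {s..T})"
        using sol1(1) sol2(1) by (simp_all add: riccati_solution_def)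
      with admissible_AE_psd_data[OF adm pos(2)] show ?thesis
      proof eventually_elim
        case (elim t)
        show ?case
        proof
          assume t: "t \<in> {s..T}"
          let ?F = "riccati_rhs \<delta> D S\<^sub>1 t - riccati_rhs \<delta> D S\<^sub>2 t"
          have "((\<lambda>t. w \<bullet> E t) has_vector_derivative w \<bullet> ?F) (at t within {s..T})"
            unfolding E_def using elim t
            by (intro bounded_linear.has_vector_derivative[OF L] has_vector_derivative_diff) simp_all
          moreover have "- (w \<bullet> ?F) \<le> norm ?F"
          proof -
            have "- (w \<bullet> ?F) \<le> norm w * norm ?F" using Cauchy_Schwarz_ineq2[of w ?F] by linarith
            also have "\<dots> \<le> 1 * norm ?F" using w by (intro mult_right_mono) auto
            finally show ?thesis by simp
          qed
          moreover have "norm ?F \<le> a * norm (E t) + b * norm (E (t - \<delta>))"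
            unfolding a_def b_def m_def E_def
            using t elim pos
            by (intro norm_riccati_rhs_diff_le[OF adm pos t] riccati_solution_psd[OF sol1]
                riccati_solution_psd[OF sol2] bound) auto
          ultimately show "\<exists>h'. ((\<lambda>t. w \<bullet> E t) has_vector_derivative h') (at t within {s..T}) \<and>
           - h' \<le> a * norm (E t) + b * norm (E (t - \<delta>)) + 0"
            by (intro exI[of _ "w \<bullet> ?F"]) simp
        qed
      qed
    qed
    ultimately show "\<exists>h. abs_continuous_on_interval s T h \<and> norm (E t0) \<le> h t0 \<and> h T \<le> 0 \<and>
        (AE t\<in>{s..T} in lebesgue. \<exists>h'. (h has_vector_derivative h') (at t within {s..T}) \<and>
           - h' \<le> a * norm (E t) + b * norm (E (t - \<delta>)) + 0)"
      using wE by (intro exI[of _ "\<lambda>t. w \<bullet> E t"]) simp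
  qed (use small t pos in auto)
  then show ?thesis by (simp add: E_def)
qed

text \<open>The order of the quantifiers makes \<open>\<delta>\<^sub>0\<close> depend on
  \<open>T\<close>, \<open>K\<close>, \<open>\<alpha>\<close> and the dimensions alone. The single
  constant \<open>K\<close> bounds the coefficients and the terminal value; \<open>\<alpha>\<close>
  counts among the bounds because it controls the inverse of \<open>calN\<close>.\<close>

theorem proposition4p1:
  fixes T K \<alpha> :: real
  assumes "T > 0" and "\<alpha> > 0"
  shows "\<exists>\<delta>\<^sub>0>0. \<forall>\<delta> s (M :: real^'n^'n) (D :: ('n::finite, 'd::finite) riccati_coeffs).
           0 < \<delta> \<and> \<delta> \<le> \<delta>\<^sub>0 \<and> 0 \<le> s \<and> s \<le> T \<and>
           transpose M = M \<and> norm M \<le> K \<and> admissible K \<alpha> \<delta> s T D \<longrightarrow>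
           (\<forall>S\<^sub>1 S\<^sub>2. riccati_solution \<delta> s T D M S\<^sub>1 \<and> S\<^sub>1 \<in> C_psd s T \<and>
                     riccati_solution \<delta> s T D M S\<^sub>2 \<and> S\<^sub>2 \<in> C_psd s T \<longrightarrow>
                     (\<forall>t\<in>{s-\<delta>..T}. S\<^sub>1 t = S\<^sub>2 t))"
proof (cases "K < 0")
  case True
  \<comment> \<open>For negative \<open>K\<close> there is no \<open>M\<close> to consider, and any
    positive \<open>\<delta>\<^sub>0\<close> will do.\<close>
  then have "\<not> norm M \<le> K" for M :: "real^'n^'n" using norm_ge_zero[of M] by linarith
  then show ?thesis by (intro exI[of _ 1]) simp
next
  case False
  then have K: "K \<ge> 0" by simp
  define n where "n = real CARD('n)"
  define d where "d = real CARD('d)"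
  define a where "a = n * (2 * K + n * K\<^sup>2)"
  define b where "b = n\<^sup>2 * K\<^sup>2"
  define c where "c = n * K\<^sup>2 * d / \<alpha>"
  define \<mu> where "\<mu> = 2 * (a + 2 * b + 1)"
  \<comment> \<open>The maximum with \<open>n\<close> covers the history, where the trace is
    \<open>n\<close>. Using \<open>T\<close> in place of \<open>T - s\<close> makes the bound
    independent of \<open>s\<close>.\<close>
  define \<rho> where "\<rho> = max n (2 * (n * K + (b * n + c) * T) * exp (\<mu> * T))"
  define m where "m = (n * (1 + 4 * K * \<rho>))\<^sup>2"
  define a' where "a' = 2 * K + 8 * K * \<rho> + K\<^sup>2 * m"
  define b' where "b' = K\<^sup>2 * m"
  \<comment> \<open>The exponent of the second Gronwall argument depends on \<open>\<rho>\<close>,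
    which the first one has fixed in terms of the data; so both smallness conditions on
    \<open>\<delta>\<close> can be imposed at once.\<close>
  define \<mu>' where "\<mu>' = 2 * (a' + 2 * b' + 1)"
  have n: "n \<ge> 0" "d \<ge> 0" by (simp_all add: n_def d_def)
  then have \<rho>: "\<rho> \<ge> 0" by (simp add: \<rho>_def)
  have abc: "a \<ge> 0" "b \<ge> 0" "c \<ge> 0" using n K \<open>\<alpha> > 0\<close> by (simp_all add: a_def b_def c_def)
  have "a' \<ge> 0" "b' \<ge> 0" using K \<rho> by (simp_all add: a'_def b'_def m_def)
  then have \<mu>: "\<mu> > 0" "\<mu>' > 0" using abc by (auto simp: \<mu>_def \<mu>'_def)
  have small: "exp (x * \<delta>) \<le> 2" if "x > 0" "\<delta> \<le> ln 2 / x" for x \<delta> :: real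
  proof -
    have "x * \<delta> \<le> ln 2" using that by (simp add: field_simps)
    then have "exp (x * \<delta>) \<le> exp (ln 2)" by (simp only: exp_le_cancel_iff)
    then show ?thesis by simp
  qed
  have "S\<^sub>1 t = S\<^sub>2 t"
    if \<delta>: "0 < \<delta>" "\<delta> \<le> min (ln 2 / \<mu>) (ln 2 / \<mu>')" and s: "0 \<le> s" "s \<le> T"
      and M: "norm M \<le> K" and adm: "admissible K \<alpha> \<delta> s T D"
      and sol1: "riccati_solution \<delta> s T D M S\<^sub>1" "S\<^sub>1 \<in> C_psd s T"
      and sol2: "riccati_solution \<delta> s T D M S\<^sub>2" "S\<^sub>2 \<in> C_psd s T"
      and t: "t \<in> {s-\<delta>..T}"
    for \<delta> s t M S\<^sub>1 S\<^sub>2 and D :: "('n::finite, 'd::finite) riccati_coeffs"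
  proof -
    have bound: "norm (S r) \<le> \<rho>"
      if sol: "riccati_solution \<delta> s T D M S" "S \<in> C_psd s T" and r: "r \<in> {s-\<delta>..T}" for S r
    proof -
      have "norm (S r) \<le> trace (S r)"
        by (rule psd_norm_le_trace) (rule riccati_solution_psd[OF sol r])
      also have "trace (S r) \<le> \<rho>"
      proof (cases "r < s")
        case True
        then have "S r = mat 1" using sol(1) r by (simp add: riccati_solution_def)
        then show ?thesis by (simp add: trace_I \<rho>_def n_def)
      next
        case False
        then have "r \<in> {s..T}" using r by simp
        then have "trace (S r) \<le> 2 * (n * K + (b * n + c) * (T - s)) * exp (\<mu> * (T - s))"
          using riccati_solution_trace_le[OF adm K \<open>\<alpha> > 0\<close> \<delta>(1) s(2) M sol] small[OF \<mu>(1), of \<delta>] \<delta>(2)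
          by (simp add: \<mu>_def a_def b_def c_def n_def d_def)
        \<comment> \<open>Here \<open>0 \<le> s\<close> enters, through
          \<open>T - s \<le> T\<close>.\<close>
        also have "\<dots> \<le> 2 * (n * K + (b * n + c) * T) * exp (\<mu> * T)"
          using s n K abc \<mu> \<open>T > 0\<close> by (intro mult_mono add_mono) auto
        finally show ?thesis by (simp add: \<rho>_def)
      qed
      finally show ?thesis .
    qed
    show ?thesis
      using riccati_solution_unique[OF adm K \<delta>(1) s(2) sol1 sol2 bound[OF sol1] bound[OF sol2] _ t]
        small[OF \<mu>(2), of \<delta>] \<delta>(2)
      by (simp add: \<mu>'_def a'_def b'_def m_def n_def)
  qed
  moreover have "min (ln 2 / \<mu>) (ln 2 / \<mu>') > 0" using \<mu> by simp
  ultimately show ?thesis by blast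
qed

end
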